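(* Let $V$ be the $\mathcal O_q$-module, with associated notation, described in the context. The maps $K,B,K^\downarrow,B^\downarrow\in\mathrm{End}(V)$ satisfy $$H^{-1}BH=aA-a^2B^{-1},\qquad H^{-1}KH=a^{-1}A-a^{-2}K^{-1},$$ $$H^{-1}B^\downarrow H=aA-a^2(B^\downarrow)^{-1},\qquad H^{-1}K^\downarrow H=a^{-1}A-a^{-2}(K^\downarrow)^{-1}.$$
   Context: Setting. $\mathbb F$ is a field and $q\in\mathbb F$ is nonzero and not a root of unity. Algebras are associative, unital, over $\mathbb F$. Write $[X,Y]=XY-YX$, $[X,Y]_q=qXY-q^{-1}YX$, $[X,Y]_{q^{-1}}=q^{-1}XY-qYX$. The $q$-Onsager algebra $\mathcal O_q$ is defined by generators $A,A^*$ and relations $[A,[A,[A,A^*]_q]_{q^{-1}}]=(q^2-q^{-2})^2[A^*,A]$ and $[A^*,[A^*,[A^*,A]_q]_{q^{-1}}]=(q^2-q^{-2})^2[A,A^*]$. $V$ is an irreducible $\mathcal O_q$-module of finite dimension at least $2$ on which each of $A,A^*$ is diagonalizable; elements of $\mathcal O_q$ are identified with their actions on $V$. Eigenspaces. The eigenvalues of $A$ on $V$ can be ordered as mutually distinct $\theta_0,\dots,\theta_d$ ($d\ge 1$) such that $\theta_i=aq^{d-2i}+a^{-1}q^{2i-d}$ ($0\le i\le d$) for some nonzero $a\in\mathbb F$; fix such an ordering and $a$. $V_i$ is the $\theta_i$-eigenspace of $A$ and $E_i\in\mathrm{End}(V)$ is the projection onto $V_i$ along $\bigoplus_{j\ne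 i}V_j$; one has $A^*V_i\subseteq V_{i-1}+V_i+V_{i+1}$ ($V_{-1}=V_{d+1}=0$). $A^*$ also has exactly $d+1$ eigenspaces on $V$, and they can be ordered $V^*_0,\dots,V^*_d$ so that $AV^*_i\subseteq V^*_{i-1}+V^*_i+V^*_{i+1}$ ($V^*_{-1}=V^*_{d+1}=0$); fix such an ordering. The map $H$. Let $t_{ij}=1+\frac{\theta_i-\theta_j}{q-q^{-1}}\cdot\frac{q\theta_i-q^{-1}\theta_j}{q^2-q^{-2}}$, $t_i=t_{01}t_{12}\cdots t_{i-1,i}$ ($t_0=1$), and $H=\sum_{i=0}^d t_iE_i\in\mathrm{End}(V)$; each $t_i\neq0$, so $H$ is invertible. Maps. A decomposition of $V$ is a sequence $\{W_i\}_{i=0}^d$ of nonzero subspaces with direct sum $V$; its corresponding map is the element of $\mathrm{End}(V)$ acting on $W_i$ as $q^{d-2i}$ times the identity ($0\le i\le d$). $K,B,K^\downarrow,B^\downarrow$ are the maps corresponding to the decompositions $\{W_i\}_{i=0}^d$ (each known to be a decomposition) given respectively by: $K$: $W_i=(V^*_0+\cdots+V^*_i)\cap(V_i+\cdots+V_d)$; $B$: $W_i=(V^*_0+\cdots+V^*_i)\cap(V_0+\cdots+V_{d-i})$; $K^\downarrow$: $W_i=(V^*_{d-i}+\cdots+V^*_d)\cap(V_i+\cdots+V_d)$; $B^\downarrow$: $W_i=(V^*_{d-i}+\cdots+V^*_d)\cap(V_0+\cdots+V_{d-i})$. It is known that each such $\{W_i\}$ has partial sums $W_0+\cdots+W_i$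 equal to the first of the two intersected subspaces and $W_i+\cdots+W_d$ equal to the second. *)

theory Defs
  imports Complex_Main "HOL-Library.Poly_Mapping" "HOL-Algebra.QuotRing"
begin

text \<open>
  The free algebra on two noncommuting letters is the monoid algebra of the free monoid of words:
  the type class of finitely supported functions takes its product from an additively written
  monoid, so concatenation of words is written as addition.
\<close>

datatype letter = Letter_A | Letter_As

datatype word = Word "letter list"

instantiation word :: monoid_add
begin

definition zero_word :: word where "zero_word = Word []"

fun plus_word :: "word \<Rightarrow> word \<Rightarrow> word" where "plus_word (Word u) (Word v) = Word (u @ v)"

instance
proof
  fix a b c :: word
  show "a + b + c = a + (b + c)" by (cases a; cases b; cases c) simp
  show "0 + a = a" by (cases a) (simp add: zero_word_def)
  show "a + 0 = a" by (cases a) (simp add: zero_word_def)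
qed

end

type_synonym 'f free_alg = "word \<Rightarrow>\<^sub>0 'f"

definition free_scalar :: "'f::field \<Rightarrow> 'f free_alg" where
  "free_scalar c = Poly_Mapping.single 0 c"

definition free_gen :: "letter \<Rightarrow> ('f::field) free_alg" where
  "free_gen l = Poly_Mapping.single (Word [l]) 1"

definition free_ring :: "('f::field) free_alg ring" where
  "free_ring = \<lparr>carrier = UNIV, mult = (*), one = 1, zero = 0, add = (+)\<rparr>"

definition commutator :: "('f::field) free_alg \<Rightarrow> 'f free_alg \<Rightarrow> 'f free_alg" where
  "commutator X Y = X * Y - Y * X"

definition qcommutator :: "'f::field \<Rightarrow> 'f free_alg \<Rightarrow> 'f free_alg \<Rightarrow> 'f free_alg" where
  "qcommutator q X Y = free_scalar q * X * Y - free_scalar (inverse q) * Y * X"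

definition q_Onsager_relator :: "'f::field \<Rightarrow> 'f free_alg \<Rightarrow> 'f free_alg \<Rightarrow> 'f free_alg" where
  "q_Onsager_relator q X Y =
     commutator X (qcommutator (inverse q) X (qcommutator q X Y))
     - free_scalar ((q^2 - inverse q^2)^2) * commutator Y X"

definition q_Onsager_ideal :: "'f::field \<Rightarrow> 'f free_alg set" where
  "q_Onsager_ideal q = genideal free_ring
     {q_Onsager_relator q (free_gen Letter_A) (free_gen Letter_As),
      q_Onsager_relator q (free_gen Letter_As) (free_gen Letter_A)}"

definition q_Onsager :: "'f::field \<Rightarrow> 'f free_alg set ring" where
  "q_Onsager q = FactRing free_ring (q_Onsager_ideal q)"

definition q_Onsager_class :: "'f::field \<Rightarrow> 'f free_alg \<Rightarrow> 'f free_alg set" where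
  "q_Onsager_class q x = a_r_coset free_ring (q_Onsager_ideal q) x"

definition q_Onsager_gen :: "'f::field \<Rightarrow> letter \<Rightarrow> 'f free_alg set" where
  "q_Onsager_gen q l = q_Onsager_class q (free_gen l)"

definition q_Onsager_scalar :: "'f::field \<Rightarrow> 'f \<Rightarrow> 'f free_alg set" where
  "q_Onsager_scalar q c = q_Onsager_class q (free_scalar c)"

text \<open>
  An algebra over the field is a ring \<open>R\<close> with a structure map \<open>\<eta>\<close> sending \<open>c\<close> to
  \<open>c\<close> times the unit. The vector space is the whole type \<open>'v\<close> with scalar multiplication \<open>scale\<close>.
\<close>

definition algebra_module ::
  "('f::field \<Rightarrow> 'v::ab_group_add \<Rightarrow> 'v) \<Rightarrow> ('r, 'm) ring_scheme \<Rightarrow> ('f \<Rightarrow> 'r) \<Rightarrow> ('r \<Rightarrow> 'v \<Rightarrow> 'v) \<Rightarrow> bool"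
where
  "algebra_module scale R \<eta> \<rho> \<longleftrightarrow>
     vector_space scale \<and>
     (\<forall>x\<in>carrier R. Vector_Spaces.linear scale scale (\<rho> x)) \<and>
     (\<forall>x\<in>carrier R. \<forall>y\<in>carrier R. \<forall>v. \<rho> (x \<oplus>\<^bsub>R\<^esub> y) v = \<rho> x v + \<rho> y v) \<and>
     (\<forall>x\<in>carrier R. \<forall>y\<in>carrier R. \<forall>v. \<rho> (x \<otimes>\<^bsub>R\<^esub> y) v = \<rho> x (\<rho> y v)) \<and>
     (\<forall>v. \<rho> \<one>\<^bsub>R\<^esub> v = v) \<and>
     (\<forall>c v. \<rho> (\<eta> c) v = scale c v)"

definition irreducible_module ::
  "('f::field \<Rightarrow> 'v::ab_group_add \<Rightarrow> 'v) \<Rightarrow> ('r, 'm) ring_scheme \<Rightarrow> ('f \<Rightarrow> 'r) \<Rightarrow> ('r \<Rightarrow> 'v \<Rightarrow> 'v) \<Rightarrow> bool"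
where
  "irreducible_module scale R \<eta> \<rho> \<longleftrightarrow>
     algebra_module scale R \<eta> \<rho> \<and>
     (UNIV :: 'v set) \<noteq> {0} \<and>
     (\<forall>W. module.subspace scale W \<and> (\<forall>x\<in>carrier R. \<forall>w\<in>W. \<rho> x w \<in> W) \<longrightarrow> W = {0} \<or> W = UNIV)"

definition eigenspace ::
  "('f::field \<Rightarrow> 'v::ab_group_add \<Rightarrow> 'v) \<Rightarrow> ('v \<Rightarrow> 'v) \<Rightarrow> 'f \<Rightarrow> 'v set" where
  "eigenspace scale X c = {v. X v = scale c v}"

definition eigenvalues ::
  "('f::field \<Rightarrow> 'v::ab_group_add \<Rightarrow> 'v) \<Rightarrow> ('v \<Rightarrow> 'v) \<Rightarrow> 'f set" where
  "eigenvalues scale X = {c. \<exists>v. v \<noteq> 0 \<and> X v = scale c v}"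

definition eigenspaces ::
  "('f::field \<Rightarrow> 'v::ab_group_add \<Rightarrow> 'v) \<Rightarrow> ('v \<Rightarrow> 'v) \<Rightarrow> 'v set set" where
  "eigenspaces scale X = eigenspace scale X ` eigenvalues scale X"

definition diagonalizable ::
  "('f::field \<Rightarrow> 'v::ab_group_add \<Rightarrow> 'v) \<Rightarrow> ('v \<Rightarrow> 'v) \<Rightarrow> bool" where
  "diagonalizable scale X \<longleftrightarrow> module.span scale (\<Union>(eigenspaces scale X)) = UNIV"

definition subspace_sum ::
  "('f::field \<Rightarrow> 'v::ab_group_add \<Rightarrow> 'v) \<Rightarrow> (nat \<Rightarrow> 'v set) \<Rightarrow> nat set \<Rightarrow> 'v set" where
  "subspace_sum scale W J = module.span scale (\<Union>j\<in>J. W j)"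

text \<open>The projection onto \<open>U\<close> along \<open>W\<close>; it exists and is unique when the space is the direct sum
  of \<open>U\<close> and \<open>W\<close>.\<close>

definition projection_along ::
  "('f::field \<Rightarrow> 'v::ab_group_add \<Rightarrow> 'v) \<Rightarrow> 'v set \<Rightarrow> 'v set \<Rightarrow> 'v \<Rightarrow> 'v" where
  "projection_along scale U W =
     (THE P. Vector_Spaces.linear scale scale P \<and> (\<forall>u\<in>U. P u = u) \<and> (\<forall>w\<in>W. P w = 0))"

text \<open>The map corresponding to a decomposition \<open>W 0, \<dots>, W d\<close>; it exists and is unique
  when the space is the direct sum of the \<open>W i\<close>.\<close>

definition corresponding_map ::
  "('f::field \<Rightarrow> 'v::ab_group_add \<Rightarrow> 'v) \<Rightarrow> 'f \<Rightarrow> nat \<Rightarrow> (nat \<Rightarrow> 'v set) \<Rightarrow> 'v \<Rightarrow> 'v" where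
  "corresponding_map scale q d W =
     (THE X. Vector_Spaces.linear scale scale X \<and>
        (\<forall>i\<le>d. \<forall>w\<in>W i. X w = scale (q powi (int d - 2 * int i)) w))"

definition t_pair :: "'f::field \<Rightarrow> 'f \<Rightarrow> 'f \<Rightarrow> 'f" where
  "t_pair q x y = 1 + (x - y) / (q - inverse q) * ((q * x - inverse q * y) / (q^2 - inverse q^2))"

definition t_coeff :: "'f::field \<Rightarrow> (nat \<Rightarrow> 'f) \<Rightarrow> nat \<Rightarrow> 'f" where
  "t_coeff q \<theta> i = (\<Prod>k<i. t_pair q (\<theta> k) (\<theta> (Suc k)))"

end

theory Submission
  imports Defs
begin

text \<open>
  The formula for \<open>K\<close> is the essential one. Reversing the order of the eigenspaces of \<open>A\<close> replaces
  \<open>a\<close> by its inverse, multiplies \<open>H\<close> by a nonzero scalar and turns \<open>K\<close> into \<open>B\<close>; reversing the order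
  of the eigenspaces of \<open>A\<^sup>*\<close> turns \<open>K\<close>, \<open>B\<close> into the two maps with a down arrow. So a
  single statement, \<open>K_conjugate\<close>, is applied four times.

  Let \<open>F n\<close> be the sum of the first \<open>n\<close> eigenspaces of \<open>A\<^sup>*\<close> and \<open>G n\<close> the sum of all
  eigenspaces of \<open>A\<close> from number \<open>n\<close> on. Up to scalars, \<open>A\<close> raises the index of both
  flags by one and \<open>A\<^sup>*\<close> lowers it by one; irreducibility then forces \<open>F n \<inter> G n = 0\<close> and makes
  \<open>W i = F (i + 1) \<inter> G i\<close> a decomposition with partial sums \<open>G n = W n + \<dots> + W d\<close>
  (\<open>F_Int_G\<close>, \<open>W_decomposition\<close>, \<open>G_eq_sum_W\<close>). That \<open>A\<^sup>*\<close> is tridiagonal with respect to the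
  eigenspaces of \<open>A\<close> is a consequence of the first defining relation of the q-Onsager algebra: on an
  eigenspace of \<open>A\<close> it becomes a cubic polynomial in \<open>A\<close> that kills the image of \<open>A\<^sup>*\<close>, and the
  roots of this cubic are the values of the formula for the eigenvalues at the index of that eigenspace
  and at the two neighbouring integers (\<open>q_Onsager_tridiagonal\<close>).

  On the decomposition, \<open>A = a K + a\<^sup>-\<^sup>1 K\<^sup>-\<^sup>1 + R\<close> where \<open>R\<close> maps \<open>W i\<close> into \<open>W (i + 1)\<close>, so that
  \<open>R K = q\<^sup>2 K R\<close>. Put \<open>K' = a\<^sup>-\<^sup>1 A - a\<^sup>-\<^sup>2 K\<^sup>-\<^sup>1 = K + a\<^sup>-\<^sup>1 R\<close>. Both \<open>X = K\<close> and
  \<open>X = K'\<close> satisfy the same quadratic relation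
  \<open>q X A - q\<^sup>-\<^sup>1 A X = (q - q\<^sup>-\<^sup>1) (a\<^sup>-\<^sup>1 + a X\<^sup>2)\<close> (\<open>K_A_relation\<close>, \<open>K'_A_relation\<close>).
  Relative to the eigenspaces of \<open>A\<close>, the solutions at hand are triangular with prescribed diagonal, and
  the relation determines every block from the blocks nearer to the diagonal, except for the blocks next
  to the diagonal. Conjugation by \<open>H\<close>, which commutes with \<open>A\<close>, preserves the relation, and the
  numbers \<open>t\<^sub>i\<close> are chosen so that it matches exactly these remaining blocks of \<open>K'\<close> with those of
  \<open>K\<close>. Hence \<open>H K' = K H\<close> (\<open>K_intertwining\<close>).
\<close>

section \<open>Endomorphisms and direct sum decompositions\<close>

locale endomorphisms = vector_space scale
  for scale :: "'f::field \<Rightarrow> 'v::ab_group_add \<Rightarrow> 'v" (infixr \<open>*s\<close> 75)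
begin

abbreviation endo :: "('v \<Rightarrow> 'v) \<Rightarrow> bool" where
  "endo f \<equiv> Vector_Spaces.linear scale scale f"

lemma endo_iff:
  "endo f \<longleftrightarrow> (\<forall>x y. f (x + y) = f x + f y) \<and> (\<forall>c x. f (c *s x) = c *s f x)"
  by (simp add: linear_iff_module_hom module_hom_iff module_axioms)

lemma endo_add: "endo f \<Longrightarrow> f (x + y) = f x + f y"
  and endo_scale: "endo f \<Longrightarrow> f (c *s x) = c *s f x"
  by (simp_all add: endo_iff)

lemma endo_zero: "endo f \<Longrightarrow> f 0 = 0"
  using endo_scale[of f 0 0] by simp

lemma endo_diff: "endo f \<Longrightarrow> f (x - y) = f x - f y"
  using endo_add[of f "x - y" y] by (simp add: algebra_simps)

lemma endo_sum: "endo f \<Longrightarrow> f (sum g I) = (\<Sum>i\<in>I. f (g i))"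
  by (induction I rule: infinite_finite_induct) (simp_all add: endo_zero endo_add)

lemma subspace_vimage_endo: "endo f \<Longrightarrow> subspace S \<Longrightarrow> subspace {v. f v \<in> S}"
  by (simp add: subspace_def endo_zero endo_add endo_scale)

lemma subspace_eigenspace: "endo X \<Longrightarrow> subspace (eigenspace scale X c)"
  by (auto simp: subspace_def eigenspace_def endo_zero endo_add endo_scale scale_right_distrib
      scale_left_commute)

lemma subspace_subspace_sum: "subspace (subspace_sum scale W J)"
  by (simp add: subspace_sum_def)

lemma subspace_sum_mono: "I \<subseteq> J \<Longrightarrow> subspace_sum scale W I \<subseteq> subspace_sum scale W J"
  unfolding subspace_sum_def by (intro span_mono) blast

lemma subspace_sum_base: "i \<in> J \<Longrightarrow> v \<in> W i \<Longrightarrow> v \<in> subspace_sum scale W J"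
  unfolding subspace_sum_def by (intro span_base) blast

lemma subspace_sum_empty: "subspace_sum scale W {} = {0}"
  by (simp add: subspace_sum_def)

lemma subspace_sum_reverse:
  "subspace_sum scale (\<lambda>i. U (d - i)) J = subspace_sum scale U ((\<lambda>i. d - i) ` J)"
  by (simp add: subspace_sum_def image_image)

text \<open>
  All inclusions between flags below are checked on the summands with this rule.
\<close>
lemma endo_subspace_sum:
  assumes "endo f" "subspace S" "\<And>i v. i \<in> J \<Longrightarrow> v \<in> W i \<Longrightarrow> f v \<in> S"
    and "v \<in> subspace_sum scale W J"
  shows "f v \<in> S"
proof -
  have "span (\<Union>i\<in>J. W i) \<subseteq> {v. f v \<in> S}"
    using assms by (intro span_minimal subspace_vimage_endo) auto
  with assms(4) show ?thesis by (auto simp: subspace_sum_def)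
qed

lemma endo_eq_on_subspace_sum:
  assumes "endo f" "endo g" "\<And>i v. i \<in> J \<Longrightarrow> v \<in> W i \<Longrightarrow> f v = g v"
    and "v \<in> subspace_sum scale W J"
  shows "f v = g v"
proof -
  have "endo (\<lambda>v. f v - g v)"
    using assms(1,2) by (simp add: endo_iff scale_right_diff_distrib)
  then have "f v - g v \<in> {0}"
    by (rule endo_subspace_sum[OF _ subspace_single_0 _ assms(4)]) (simp add: assms(3))
  then show ?thesis by simp
qed

lemma in_subspace_sumE:
  assumes "v \<in> subspace_sum scale W J" "finite J" "\<And>i. i \<in> J \<Longrightarrow> subspace (W i)"
  obtains u where "\<And>i. i \<in> J \<Longrightarrow> u i \<in> W i" "v = (\<Sum>i\<in>J. u i)"
proof -
  let ?S = "{v. \<exists>u. (\<forall>i\<in>J. u i \<in> W i) \<and> v = (\<Sum>i\<in>J. u i)}"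
  have "subspace ?S"
  proof (intro subspaceI)
    show "0 \<in> ?S" using assms(3) by (auto intro!: exI[of _ "\<lambda>_. 0"] simp: subspace_0)
  next
    fix x y assume "x \<in> ?S" "y \<in> ?S"
    then obtain u w where "\<forall>i\<in>J. u i \<in> W i" "x = (\<Sum>i\<in>J. u i)"
      "\<forall>i\<in>J. w i \<in> W i" "y = (\<Sum>i\<in>J. w i)" by auto
    then show "x + y \<in> ?S"
      using assms(3) by (auto intro!: exI[of _ "\<lambda>i. u i + w i"] simp: subspace_add sum.distrib)
  next
    fix c x assume "x \<in> ?S"
    then obtain u where "\<forall>i\<in>J. u i \<in> W i" "x = (\<Sum>i\<in>J. u i)" by auto
    then show "c *s x \<in> ?S"
      using assms(3)
      by (auto intro!: exI[of _ "\<lambda>i. c *s u i"] simp: subspace_scale scale_sum_right)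
  qed
  moreover have "(\<Union>i\<in>J. W i) \<subseteq> ?S"
  proof clarify
    fix i v assume i: "i \<in> J" and v: "v \<in> W i"
    show "\<exists>u. (\<forall>i\<in>J. u i \<in> W i) \<and> v = (\<Sum>i\<in>J. u i)"
      using i v assms(2,3)
      by (intro exI[of _ "\<lambda>j. if j = i then v else 0"]) (auto simp: subspace_0)
  qed
  ultimately have "span (\<Union>i\<in>J. W i) \<subseteq> ?S" by (intro span_minimal)
  with assms(1) that show thesis by (auto simp: subspace_sum_def)
qed

definition decomposition :: "nat \<Rightarrow> (nat \<Rightarrow> 'v set) \<Rightarrow> bool" where
  "decomposition d W \<longleftrightarrow> (\<forall>i\<le>d. subspace (W i)) \<and> subspace_sum scale W {..d} = UNIV \<and>
     (\<forall>u. (\<forall>i\<le>d. u i \<in> W i) \<longrightarrow> (\<Sum>i\<le>d. u i) = 0 \<longrightarrow> (\<forall>i\<le>d. u i = 0))"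

text \<open>
  This makes the definite descriptions in the definitions of projections and of corresponding maps
  meaningful.
\<close>
lemma decomposition_ex1_endo:
  assumes "decomposition d W"
  shows "\<exists>!X. endo X \<and> (\<forall>i\<le>d. \<forall>w\<in>W i. X w = c i *s w)"
proof -
  have sub: "\<And>i. i \<le> d \<Longrightarrow> subspace (W i)" and span: "subspace_sum scale W {..d} = UNIV"
    and ind: "\<And>u i. (\<And>i. i \<le> d \<Longrightarrow> u i \<in> W i) \<Longrightarrow> (\<Sum>i\<le>d. u i) = 0 \<Longrightarrow> i \<le> d \<Longrightarrow> u i = 0"
    using assms unfolding decomposition_def by blast+
  have "\<exists>u. (\<forall>i\<le>d. u i \<in> W i) \<and> v = (\<Sum>i\<le>d. u i)" for v
    using in_subspace_sumE[of v W "{..d}"] sub span by (metis UNIV_I atMost_iff finite_atMost)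
  then obtain u where u: "\<And>v i. i \<le> d \<Longrightarrow> u v i \<in> W i" "\<And>v. (\<Sum>i\<le>d. u v i) = v"
    by metis
  have u_unique: "u v i = w i" if "\<And>i. i \<le> d \<Longrightarrow> w i \<in> W i" "(\<Sum>i\<le>d. w i) = v" "i \<le> d" for v w i
    using ind[of "\<lambda>i. u v i - w i" i] that u sub by (simp add: subspace_diff sum_subtractf)
  define X where "X v = (\<Sum>i\<le>d. c i *s u v i)" for v
  have "u (x + y) i = u x i + u y i" if "i \<le> d" for x y i
    using that u sub by (intro u_unique) (auto simp: subspace_add sum.distrib)
  moreover have "u (k *s x) i = k *s u x i" if "i \<le> d" for x k i
    using that u sub by (intro u_unique) (auto simp: subspace_scale scale_sum_right[symmetric])
  ultimately have X: "endo X"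
    unfolding endo_iff X_def
    by (simp add: scale_right_distrib sum.distrib scale_sum_right mult.commute)
  have X_W: "X w = c i *s w" if "i \<le> d" "w \<in> W i" for i w
  proof -
    have "u w j = (if j = i then w else 0)" if "j \<le> d" for j
      using that \<open>i \<le> d\<close> \<open>w \<in> W i\<close> sub by (intro u_unique) (auto simp: subspace_0)
    then have "X w = (\<Sum>j\<le>d. if j = i then c i *s w else 0)"
      unfolding X_def by (intro sum.cong) auto
    with \<open>i \<le> d\<close> show ?thesis by simp
  qed
  have unique: "Y = X" if Y: "endo Y" "\<And>i w. i \<le> d \<Longrightarrow> w \<in> W i \<Longrightarrow> Y w = c i *s w" for Y
  proof
    fix v
    have "Y w = X w" if "i \<in> {..d}" "w \<in> W i" for i w
      using that Y(2) X_W by simp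
    then show "Y v = X v"
      by (rule endo_eq_on_subspace_sum[where J = "{..d}" and W = W, OF Y(1) X]) (simp_all add: span)
  qed
  show ?thesis
  proof (rule ex1I[of _ X])
    show "endo X \<and> (\<forall>i\<le>d. \<forall>w\<in>W i. X w = c i *s w)" using X X_W by simp
    show "Y = X" if "endo Y \<and> (\<forall>i\<le>d. \<forall>w\<in>W i. Y w = c i *s w)" for Y
      using that by (intro unique) simp_all
  qed
qed

lemma corresponding_map_spec:
  assumes "decomposition d W"
  shows "endo (corresponding_map scale q d W)"
    and "\<And>i w. i \<le> d \<Longrightarrow> w \<in> W i \<Longrightarrow>
      corresponding_map scale q d W w = q powi (int d - 2 * int i) *s w"
  using theI'[OF decomposition_ex1_endo[OF assms, of "\<lambda>i. q powi (int d - 2 * int i)"]]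
  unfolding corresponding_map_def by blast+

lemma corresponding_map_cong:
  assumes "\<And>i. i \<le> d \<Longrightarrow> W i = W' i"
  shows "corresponding_map scale q d W = corresponding_map scale q d W'"
  using assms unfolding corresponding_map_def by (intro arg_cong[where f = The] ext) auto

text \<open>
  Being the projection onto one summand along the sum of the others is the same as acting by the
  scalars 1 and 0 on the summands, which reduces the claim to the existence of such maps.
\<close>
lemma projection_along_spec:
  assumes dec: "decomposition d W" and i: "i \<le> d"
  shows "endo (projection_along scale (W i) (subspace_sum scale W ({..d} - {i})))" (is "endo ?P")
    and "\<And>j w. j \<le> d \<Longrightarrow> w \<in> W j \<Longrightarrow>
      projection_along scale (W i) (subspace_sum scale W ({..d} - {i})) w = (if j = i then w else 0)"
proof -
  let ?S = "subspace_sum scale W ({..d} - {i})"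
  define P where "P = projection_along scale (W i) ?S"
  have "endo X \<and> (\<forall>u\<in>W i. X u = u) \<and> (\<forall>w\<in>?S. X w = 0)
      \<longleftrightarrow> endo X \<and> (\<forall>j\<le>d. \<forall>w\<in>W j. X w = (if j = i then 1 else 0) *s w)" (is "?L X \<longleftrightarrow> ?R X") for X
  proof
    assume L: "?L X"
    then have "X w = 0" if "j \<le> d" "j \<noteq> i" "w \<in> W j" for j w
      using that subspace_sum_base[of j "{..d} - {i}" w W] by simp
    with L show "?R X" by simp
  next
    assume R: "?R X"
    then have zero: "X w \<in> {0}" if "j \<in> {..d} - {i}" "w \<in> W j" for j w
      using that R by auto
    have "X w = 0" if "w \<in> ?S" for w
      using endo_subspace_sum[OF conjunct1[OF R] subspace_single_0 zero that] by simp
    moreover have "X u = u" if "u \<in> W i" for u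
      using R i that by simp
    ultimately show "?L X" using R by blast
  qed
  then have P: "P = (THE X. endo X \<and> (\<forall>j\<le>d. \<forall>w\<in>W j. X w = (if j = i then 1 else 0) *s w))"
    unfolding P_def projection_along_def by (intro arg_cong[where f = The] ext)
  have "endo P \<and> (\<forall>j\<le>d. \<forall>w\<in>W j. P w = (if j = i then 1 else 0) *s w)"
    unfolding P by (rule theI'[OF decomposition_ex1_endo[OF dec]])
  then show "endo ?P" and "\<And>j w. j \<le> d \<Longrightarrow> w \<in> W j \<Longrightarrow> ?P w = (if j = i then w else 0)"
    unfolding P_def by (blast, simp)
qed

lemma eigenvectors_independent:
  assumes X: "endo X" and "finite I" "inj_on c I"
    and "\<And>i. i \<in> I \<Longrightarrow> X (u i) = c i *s u i" "(\<Sum>i\<in>I. u i) = 0" "i \<in> I"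
  shows "u i = 0"
  using assms(2-)
proof (induction I arbitrary: u i rule: finite_induct)
  case (insert j I)
  have j: "j \<notin> I" and fin: "finite I" using insert.hyps by auto
  have eig: "\<And>i. i \<in> insert j I \<Longrightarrow> X (u i) = c i *s u i" using insert.prems(2) .
  have sum: "(\<Sum>i\<in>insert j I. u i) = 0" using insert.prems(3) .
  have ne: "c i \<noteq> c j" if "i \<in> I" for i
    using insert.prems(1) j that by (auto simp: inj_on_def)
  have inj: "inj_on c I" using insert.prems(1) by (rule inj_on_subset) auto
  have "(\<Sum>i\<in>I. (c i - c j) *s u i) = (\<Sum>i\<in>insert j I. X (u i) - c j *s u i)"
    using j fin eig by (simp add: scale_left_diff_distrib)
  also have "\<dots> = X (\<Sum>i\<in>insert j I. u i) - c j *s (\<Sum>i\<in>insert j I. u i)"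
    by (simp only: endo_sum[OF X] scale_sum_right sum_subtractf)
  also have "\<dots> = 0"
    unfolding sum by (simp add: endo_zero[OF X])
  finally have sum': "(\<Sum>i\<in>I. (c i - c j) *s u i) = 0" .
  have zero: "(c i - c j) *s u i = 0" if "i \<in> I" for i
  proof (rule insert.IH[OF inj _ sum' that])
    show "X ((c k - c j) *s u k) = c k *s ((c k - c j) *s u k)" if "k \<in> I" for k
      using that eig[of k] by (simp add: endo_scale[OF X] mult.commute)
  qed
  have I: "u i = 0" if "i \<in> I" for i
    using zero[OF that] ne[OF that] by simp
  have "u j = 0" using sum I j fin by simp
  with I show ?case using insert.prems(4) by blast
qed auto

lemma decomposition_eigenspaces:
  assumes "endo X" "inj_on c {..d}"
    and "subspace_sum scale (\<lambda>i. eigenspace scale X (c i)) {..d} = UNIV"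
  shows "decomposition d (\<lambda>i. eigenspace scale X (c i))"
  unfolding decomposition_def
proof (intro conjI allI impI)
  fix u i
  assume "\<forall>i\<le>d. u i \<in> eigenspace scale X (c i)" "(\<Sum>i\<le>d. u i) = 0" "i \<le> d"
  then show "u i = 0"
    by (intro eigenvectors_independent[OF assms(1) finite_atMost assms(2), of u i])
       (auto simp: eigenspace_def)
qed (simp_all add: assms subspace_eigenspace)

end

section \<open>Eigenvalues of q-Racah type\<close>

locale q_Racah_spectrum =
  fixes q a :: "'f::field" and d :: nat and \<theta> :: "nat \<Rightarrow> 'f"
  assumes q0: "q \<noteq> 0" and q_power: "\<And>n. n > 0 \<Longrightarrow> q ^ n \<noteq> 1" and a0: "a \<noteq> 0"
    and theta: "\<And>i. i \<le> d \<Longrightarrow>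
          \<theta> i = a * q powi (int d - 2 * int i) + inverse a * q powi (2 * int i - int d)"
    and theta_inj: "inj_on \<theta> {..d}"
begin

text \<open>
  The eigenvalue of \<open>K\<close> on the summand number \<open>i\<close>.
\<close>
definition \<kappa> :: "nat \<Rightarrow> 'f" where "\<kappa> i = q powi (int d - 2 * int i)"

lemma kappa_nonzero: "\<kappa> i \<noteq> 0"
  by (simp add: \<kappa>_def q0)

lemma kappa_add: "\<kappa> i = q ^ (2 * m) * \<kappa> (i + m)"
proof -
  have "\<kappa> i = q powi (int (2 * m) + (int d - 2 * int (i + m)))"
    by (simp add: \<kappa>_def)
  also have "\<dots> = q powi int (2 * m) * q powi (int d - 2 * int (i + m))"
    using q0 by (intro power_int_add) auto
  finally show ?thesis by (simp only: \<kappa>_def power_int_of_nat)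
qed

lemma kappa_Suc: "\<kappa> i = q\<^sup>2 * \<kappa> (Suc i)"
  using kappa_add[of i 1] by simp

lemma theta_kappa: "i \<le> d \<Longrightarrow> \<theta> i = a * \<kappa> i + inverse a * inverse (\<kappa> i)"
  unfolding theta \<kappa>_def power_int_minus[symmetric] by simp

text \<open>
  The difference of two eigenvalues factors as
  \<open>\<theta> i - \<theta> j = a (\<kappa> i - \<kappa> j) (1 - 1 / (a\<^sup>2 \<kappa> i \<kappa> j))\<close>, so the second factor cannot vanish.
\<close>
lemma kappa_product_noneq:
  assumes "i \<le> d" "j \<le> d" "i \<noteq> j"
  shows "a\<^sup>2 * \<kappa> i * \<kappa> j \<noteq> 1"
proof
  assume "a\<^sup>2 * \<kappa> i * \<kappa> j = 1"
  then have "inverse a * inverse (\<kappa> i) = a * \<kappa> j" "inverse a * inverse (\<kappa> j) = a * \<kappa> i"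
    using a0 kappa_nonzero[of i] kappa_nonzero[of j] by (simp_all add: field_simps power2_eq_square)
  then have "\<theta> i = \<theta> j" using assms by (simp add: theta_kappa)
  with assms theta_inj show False by (auto simp: inj_on_def)
qed

lemma kappa_reverse: "i \<le> d \<Longrightarrow> \<kappa> (d - i) = inverse (\<kappa> i)"
  unfolding \<kappa>_def power_int_minus[symmetric] by (simp add: of_nat_diff)

lemma q_power_2: "q\<^sup>2 - 1 \<noteq> 0" "q ^ 4 - 1 \<noteq> 0"
  using q_power[of 2] q_power[of 4] by simp_all

text \<open>
  With \<open>y = a q \<kappa> (i + 1)\<close> the two fractions in \<open>t_pair\<close> are \<open>y - 1 / y\<close> and \<open>y\<close>, so that the
  whole is \<open>y\<^sup>2\<close>.
\<close>
lemma t_pair_theta: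
  assumes "Suc i \<le> d"
  shows "t_pair q (\<theta> i) (\<theta> (Suc i)) = a\<^sup>2 * \<kappa> i * \<kappa> (Suc i)"
proof -
  let ?y = "\<kappa> (Suc i)"
  have y: "?y \<noteq> 0" by (rule kappa_nonzero)
  have th: "\<theta> i = a * q\<^sup>2 * ?y + inverse (a * q\<^sup>2 * ?y)" "\<theta> (Suc i) = a * ?y + inverse (a * ?y)"
    using assms a0 q0 y by (simp_all add: theta_kappa kappa_Suc[of i] mult.assoc)
  have q2: "q - inverse q \<noteq> 0"
    using q_power_2(1) q0 by (simp add: field_simps power2_eq_square)
  have q4: "q\<^sup>2 - (inverse q)\<^sup>2 \<noteq> 0"
    using q_power_2(2) q0 by (simp add: field_simps power2_eq_square power4_eq_xxxx)
  have 1: "\<theta> i - \<theta> (Suc i) = (q - inverse q) * (a * q * ?y - inverse (a * q * ?y))"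
    unfolding th using a0 q0 y by (simp add: field_simps power2_eq_square)
  have 2: "q * \<theta> i - inverse q * \<theta> (Suc i) = (q\<^sup>2 - (inverse q)\<^sup>2) * (a * q * ?y)"
    unfolding th using a0 q0 y by (simp add: field_simps power2_eq_square)
  have "t_pair q (\<theta> i) (\<theta> (Suc i)) = 1 + (a * q * ?y - inverse (a * q * ?y)) * (a * q * ?y)"
    unfolding t_pair_def 1 2 using q2 q4 by simp
  also have "\<dots> = a\<^sup>2 * \<kappa> i * ?y"
    unfolding kappa_Suc[of i] using a0 q0 y by (simp add: field_simps power2_eq_square)
  finally show ?thesis .
qed

lemma t_coeff_Suc:
  "Suc i \<le> d \<Longrightarrow> t_coeff q \<theta> (Suc i) = a\<^sup>2 * \<kappa> i * \<kappa> (Suc i) * t_coeff q \<theta> i"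
  by (simp add: t_coeff_def t_pair_theta mult.commute)

lemma t_coeff_nonzero: "i \<le> d \<Longrightarrow> t_coeff q \<theta> i \<noteq> 0"
  by (induction i) (simp_all add: t_coeff_Suc a0 kappa_nonzero t_coeff_def[of q \<theta> 0])

text \<open>
  In terms of \<open>X = a \<kappa> k\<close> and \<open>Z = a \<kappa> j\<close> the quadratic factors into four binomials. Two of them
  vanish only if a power of \<open>q\<close> other than the zeroth is 1; the other two compare \<open>\<theta>\<close> at a neighbour of
  one index with \<open>\<theta>\<close> at the other index. The neighbour is taken towards the other index, which keeps it
  in the range where \<open>\<theta>\<close> is injective.
\<close>
lemma q_Onsager_factor_nonzero:
  assumes "k \<le> d" "j + 2 \<le> k"
  shows "(\<theta> k)\<^sup>2 + (\<theta> j)\<^sup>2 - (q\<^sup>2 + (inverse q)\<^sup>2) * \<theta> k * \<theta> j + (q\<^sup>2 - (inverse q)\<^sup>2)\<^sup>2 \<noteq> 0"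
proof -
  define X where "X = a * \<kappa> k"
  define Z where "Z = a * \<kappa> j"
  have X0: "X \<noteq> 0" and Z0: "Z \<noteq> 0" by (simp_all add: X_def Z_def a0 kappa_nonzero)
  define m where "m = k - j"
  have m: "m \<ge> 2" "k = j + m" using assms by (simp_all add: m_def)
  have Z: "Z = q ^ (2 * m) * X" using kappa_add[of j m] by (simp add: X_def Z_def m(2))
  have "q ^ (2 + 2 * m) \<noteq> 1" by (rule q_power) simp
  then have 1: "X - q\<^sup>2 * Z \<noteq> 0" using X0 by (simp add: Z power_add power2_eq_square mult.assoc[symmetric])
  have "q ^ (2 * m) = q ^ (2 + (2 * m - 2))"
    by (rule arg_cong[where f = "\<lambda>n. q ^ n"]) (use m(1) in simp)
  then have "q ^ (2 * m) = q\<^sup>2 * q ^ (2 * m - 2)" by (simp only: power_add)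
  moreover have "q ^ (2 * m - 2) \<noteq> 1" using m(1) by (intro q_power) simp
  ultimately have 2: "q\<^sup>2 * X - Z \<noteq> 0" using X0 q0 by (simp add: Z)
  obtain l where l: "k = Suc l" using assms by (cases k) auto
  have 3: "X * Z * q\<^sup>2 - 1 \<noteq> 0"
    using kappa_product_noneq[of l j] assms kappa_Suc[of l]
    by (simp add: X_def Z_def l power2_eq_square mult.assoc mult.commute mult.left_commute)
  have "q\<^sup>2 * (a\<^sup>2 * \<kappa> k * \<kappa> (Suc j)) \<noteq> q\<^sup>2"
    using kappa_product_noneq[of k "Suc j"] assms q0 by simp
  then have 4: "X * Z - q\<^sup>2 \<noteq> 0"
    by (simp add: X_def Z_def kappa_Suc[of j] power2_eq_square mult.commute mult.left_commute)
  have th: "\<theta> k = X + inverse X" "\<theta> j = Z + inverse Z"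
    using assms by (simp_all add: X_def Z_def theta_kappa)
  have "q ^ 4 * X\<^sup>2 * Z\<^sup>2 * ((\<theta> k)\<^sup>2 + (\<theta> j)\<^sup>2 - (q\<^sup>2 + (inverse q)\<^sup>2) * \<theta> k * \<theta> j
      + (q\<^sup>2 - (inverse q)\<^sup>2)\<^sup>2) = (X - q\<^sup>2 * Z) * (q\<^sup>2 * X - Z) * (X * Z * q\<^sup>2 - 1) * (X * Z - q\<^sup>2)"
    unfolding th using X0 Z0 q0 
    by (simp add: divide_simps) (simp add: algebra_simps power2_eq_square power4_eq_xxxx)
  with 1 2 3 4 show ?thesis by auto
qed

lemma nonadjacent_theta:
  assumes "j \<le> d" "k \<le> d" "\<not> (j \<le> k + 1 \<and> k \<le> j + 1)"
  shows "(\<theta> k - \<theta> j) * ((\<theta> k)\<^sup>2 + (\<theta> j)\<^sup>2 - (q\<^sup>2 + (inverse q)\<^sup>2) * \<theta> k * \<theta> j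
    + (q\<^sup>2 - (inverse q)\<^sup>2)\<^sup>2) \<noteq> 0"
proof -
  have "\<theta> k \<noteq> \<theta> j" using assms inj_on_eq_iff[OF theta_inj, of k j] by auto
  moreover have "(\<theta> k)\<^sup>2 + (\<theta> j)\<^sup>2 - (q\<^sup>2 + (inverse q)\<^sup>2) * \<theta> k * \<theta> j + (q\<^sup>2 - (inverse q)\<^sup>2)\<^sup>2 \<noteq> 0"
  proof (cases "j + 2 \<le> k")
    case True
    then show ?thesis using assms q_Onsager_factor_nonzero by simp
  next
    case False
    then have "k + 2 \<le> j" using assms(3) by linarith
    then show ?thesis
      using q_Onsager_factor_nonzero[of j k] assms by (simp add: add.commute mult.commute mult.left_commute)
  qed
  ultimately show ?thesis by simp
qed

end

section \<open>The split decomposition\<close>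

text \<open>
  The facts about the two operators that the proof uses, in a form that is symmetric under reversing the
  order of either family of eigenspaces.
\<close>
locale tridiagonal_system = endomorphisms scale + q_Racah_spectrum q a d \<theta>
  for scale :: "'f::field \<Rightarrow> 'v::ab_group_add \<Rightarrow> 'v" (infixr \<open>*s\<close> 75)
    and q a :: 'f and d :: nat and \<theta> :: "nat \<Rightarrow> 'f" +
  fixes A As :: "'v \<Rightarrow> 'v" and \<theta>s :: "nat \<Rightarrow> 'f" and V Vs :: "nat \<Rightarrow> 'v set"
  assumes A: "endo A" and As: "endo As"
    and V: "\<And>i. i \<le> d \<Longrightarrow> V i = eigenspace scale A (\<theta> i)"
    and V_nonzero: "\<And>i. i \<le> d \<Longrightarrow> V i \<noteq> {0}"
    and V_span: "subspace_sum scale V {..d} = UNIV"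
    and Vs: "\<And>i. i \<le> d \<Longrightarrow> Vs i = eigenspace scale As (\<theta>s i)"
    and Vs_nonzero: "\<And>i. i \<le> d \<Longrightarrow> Vs i \<noteq> {0}"
    and A_Vs: "\<And>i. i \<le> d \<Longrightarrow> A ` Vs i \<subseteq> subspace_sum scale Vs {j. j \<le> d \<and> i \<le> j + 1 \<and> j \<le> i + 1}"
    and As_V: "\<And>i. i \<le> d \<Longrightarrow> As ` V i \<subseteq> subspace_sum scale V {j. j \<le> d \<and> i \<le> j + 1 \<and> j \<le> i + 1}"
    and irreducible: "\<And>W. subspace W \<Longrightarrow> A ` W \<subseteq> W \<Longrightarrow> As ` W \<subseteq> W \<Longrightarrow> W = {0} \<or> W = UNIV"
begin

text \<open>
  Only the indices up to \<open>d\<close> matter. The flags are indexed such that \<open>F 0\<close> and \<open>G (d + 1)\<close> are zero;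
  the index of \<open>F\<close> is the number of summands.
\<close>
definition F :: "nat \<Rightarrow> 'v set" where "F n = subspace_sum scale Vs {..<n}"
definition G :: "nat \<Rightarrow> 'v set" where "G n = subspace_sum scale V {n..d}"

lemma subspace_F: "subspace (F n)" and subspace_G: "subspace (G n)"
  by (simp_all add: F_def G_def subspace_subspace_sum)

lemma F_0: "F 0 = {0}" and G_beyond: "n > d \<Longrightarrow> G n = {0}" and G_0: "G 0 = UNIV"
  using V_span by (simp_all add: F_def G_def subspace_sum_empty atLeast0AtMost)

lemma F_mono: "m \<le> n \<Longrightarrow> F m \<subseteq> F n" and G_antimono: "m \<le> n \<Longrightarrow> G n \<subseteq> G m"
  unfolding F_def G_def by (intro subspace_sum_mono; auto)+

lemma V_subset_G: "i \<le> d \<Longrightarrow> n \<le> i \<Longrightarrow> V i \<subseteq> G n"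
  and Vs_subset_F: "i < n \<Longrightarrow> Vs i \<subseteq> F n"
  unfolding F_def G_def by (auto intro: subspace_sum_base)

lemma A_eigen: "i \<le> d \<Longrightarrow> v \<in> V i \<Longrightarrow> A v = \<theta> i *s v"
  and As_eigen: "i \<le> d \<Longrightarrow> v \<in> Vs i \<Longrightarrow> As v = \<theta>s i *s v"
  using V Vs by (auto simp: eigenspace_def)

lemma endo_minus_scalar: "endo X \<Longrightarrow> endo (\<lambda>v. X v - c *s v)"
  by (simp add: endo_iff scale_right_diff_distrib scale_right_distrib scale_left_commute)

lemma A_G:
  assumes "v \<in> G n"
  shows "A v - \<theta> n *s v \<in> G (Suc n)"
proof (rule endo_subspace_sum[OF endo_minus_scalar[OF A] subspace_G _ assms[unfolded G_def]])
  fix j w assume j: "j \<in> {n..d}" and w: "w \<in> V j"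
  show "A w - \<theta> n *s w \<in> G (Suc n)"
  proof (cases "j = n")
    case True
    then show ?thesis using j w by (simp add: A_eigen[of n] subspace_0 subspace_G)
  next
    case False
    then have "w \<in> G (Suc n)" using j w V_subset_G[of j "Suc n"] by auto
    then show ?thesis
      using j w subspace_G by (simp add: A_eigen[of j] subspace_diff subspace_scale)
  qed
qed

lemma As_G:
  assumes "v \<in> G (Suc n)"
  shows "As v \<in> G n"
proof (rule endo_subspace_sum[OF As subspace_G _ assms[unfolded G_def]])
  fix j w assume j: "j \<in> {Suc n..d}" and w: "w \<in> V j"
  then have "As w \<in> subspace_sum scale V {k. k \<le> d \<and> j \<le> k + 1 \<and> k \<le> j + 1}"
    using As_V[of j] by auto
  also have "\<dots> \<subseteq> G n"
    unfolding G_def using j by (intro subspace_sum_mono) auto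
  finally show "As w \<in> G n" .
qed

lemma A_F:
  assumes "v \<in> F n" "n \<le> Suc d"
  shows "A v \<in> F (Suc n)"
proof (rule endo_subspace_sum[OF A subspace_F _ assms(1)[unfolded F_def]])
  fix j w assume j: "j \<in> {..<n}" and w: "w \<in> Vs j"
  then have "A w \<in> subspace_sum scale Vs {k. k \<le> d \<and> j \<le> k + 1 \<and> k \<le> j + 1}"
    using A_Vs[of j] assms(2) by auto
  also have "\<dots> \<subseteq> F (Suc n)"
    unfolding F_def using j by (intro subspace_sum_mono) auto
  finally show "A w \<in> F (Suc n)" .
qed

lemma As_F:
  assumes "v \<in> F (Suc n)" "n \<le> d"
  shows "As v - \<theta>s n *s v \<in> F n"
proof (rule endo_subspace_sum[OF endo_minus_scalar[OF As] subspace_F _ assms(1)[unfolded F_def]])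
  fix j w assume j: "j \<in> {..<Suc n}" and w: "w \<in> Vs j"
  show "As w - \<theta>s n *s w \<in> F n"
  proof (cases "j = n")
    case True
    then show ?thesis using w assms(2) by (simp add: As_eigen[of n] subspace_0 subspace_F)
  next
    case False
    then have "w \<in> F n" using j w Vs_subset_F[of j n] by auto
    then show ?thesis
      using j w assms(2) subspace_F by (simp add: As_eigen[of j] subspace_diff subspace_scale)
  qed
qed

lemma span_shift_chain:
  assumes A_U: "\<And>n v. v \<in> U n \<Longrightarrow> A v - \<alpha> n *s v \<in> U (Suc n)"
    and As_U: "\<And>n v. v \<in> U n \<Longrightarrow> As v - \<beta> n *s v \<in> insert 0 (U (n - 1))"
  shows "span (\<Union>n. U n) = {0} \<or> span (\<Union>n. U n) = UNIV"
proof -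
  let ?S = "span (\<Union>n. U n)"
  have base: "v \<in> U n \<Longrightarrow> v \<in> ?S" for v n by (intro span_base) auto
  have invariant: "X ` ?S \<subseteq> ?S"
    if X: "endo X" and XU: "\<And>n v. v \<in> U n \<Longrightarrow> X v - c n *s v \<in> ?S" for X c
  proof -
    have "X v \<in> ?S" if "v \<in> U n" for n v
      using span_add[OF XU[OF that] span_scale[OF base[OF that], of "c n"]] by simp
    then have "?S \<subseteq> {v. X v \<in> ?S}"
      using X by (intro span_minimal subspace_vimage_endo) auto
    then show ?thesis by auto
  qed
  have "A ` ?S \<subseteq> ?S"
    using A_U base by (intro invariant[OF A, of \<alpha>]) blast
  moreover have "As ` ?S \<subseteq> ?S"
  proof (rule invariant[OF As])
    fix n v assume "v \<in> U n"
    then show "As v - \<beta> n *s v \<in> ?S" using As_U[of v n] base span_zero by auto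
  qed
  ultimately show ?thesis by (intro irreducible) auto
qed

text \<open>
  The operators \<open>A - \<theta> n\<close> and \<open>A\<^sup>* - \<theta>\<^sup>* (n + r - 1)\<close> move \<open>F (n + r) \<inter> G n\<close> one step up and one
  step down in \<open>n\<close>. For \<open>r = 0\<close> the span is contained in the proper subspace \<open>G 1\<close> and must vanish; for
  \<open>r = 1\<close> it contains the first eigenspace of \<open>A\<^sup>*\<close> and must be everything.
\<close>
lemma span_F_Int_G:
  assumes "r \<le> 1"
  shows "span (\<Union>n. F (n + r) \<inter> G n) = {0} \<or> span (\<Union>n. F (n + r) \<inter> G n) = UNIV"
proof (rule span_shift_chain[of _ \<theta> "\<lambda>n. \<theta>s (n + r - 1)"])
  fix n v assume v: "v \<in> F (n + r) \<inter> G n"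
  show "A v - \<theta> n *s v \<in> F (Suc n + r) \<inter> G (Suc n)"
  proof (cases "n \<le> d")
    case True
    with v assms have "A v \<in> F (Suc n + r)" using A_F[of v "n + r"] by simp
    moreover have "v \<in> F (Suc n + r)" using v F_mono[of "n + r" "Suc n + r"] by auto
    ultimately show ?thesis
      using v A_G by (simp add: subspace_diff subspace_scale subspace_F)
  next
    case False
    then have "v = 0" using v G_beyond[of n] by simp
    then show ?thesis by (simp add: endo_zero[OF A] subspace_0 subspace_F subspace_G)
  qed
  show "As v - \<theta>s (n + r - 1) *s v \<in> insert 0 (F (n - 1 + r) \<inter> G (n - 1))"
  proof (cases "n + r = 0 \<or> n > d")
    case True
    then have "v \<in> {0}"
    proof
      assume "n + r = 0"
      with v F_0 show ?thesis by simp
    next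
      assume "n > d"
      with v G_beyond[of n] show ?thesis by simp
    qed
    then show ?thesis by (simp add: endo_zero[OF As])
  next
    case False
    then obtain m where m: "n + r = Suc m" using not0_implies_Suc by blast
    have F: "As v - \<theta>s m *s v \<in> F m" using v m False assms As_F[of v m] by auto
    show ?thesis
    proof (cases n)
      case 0
      then have "F m = {0}" using m assms F_0 by simp
      then show ?thesis using F m by simp
    next
      case (Suc k)
      have "v \<in> G k" using v Suc G_antimono[of k n] by auto
      then have "As v - \<theta>s m *s v \<in> G k"
        using v Suc As_G[of v k] by (simp add: subspace_diff subspace_scale subspace_G)
      then show ?thesis using F m Suc by simp
    qed
  qed
qed

lemma G_1_proper: "G 1 \<noteq> UNIV"
proof
  assume G1: "G 1 = UNIV"
  obtain v where v: "v \<in> V 0" "v \<noteq> 0"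
    using V_nonzero[of 0] V[of 0] subspace_0[OF subspace_eigenspace[OF A, of "\<theta> 0"]] by auto
  have sub: "subspace (V i)" if "i \<le> d" for i using that by (simp add: V subspace_eigenspace A)
  from G1 have "v \<in> subspace_sum scale V {1..d}" by (simp add: G_def)
  then obtain u where u: "\<And>i. i \<in> {1..d} \<Longrightarrow> u i \<in> V i" "v = (\<Sum>i\<in>{1..d}. u i)"
    using sub by (elim in_subspace_sumE) auto
  define w where "w i = (if i = 0 then - v else u i)" for i
  have "(\<Sum>i\<le>d. w i) = w 0 + (\<Sum>i\<in>{1..d}. w i)"
    by (simp add: atLeast0AtMost[symmetric] sum.atLeast_Suc_atMost)
  also have "\<dots> = 0" using u(2) by (simp add: w_def)
  finally have "(\<Sum>i\<in>{..d}. w i) = 0" by simp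
  moreover have "A (w i) = \<theta> i *s w i" if "i \<in> {..d}" for i
    using that u(1)[of i] A_eigen[of 0 "- v"] subspace_neg[OF sub[of 0] v(1)] A_eigen[of i "u i"]
    by (cases "i = 0") (auto simp: w_def)
  ultimately have "w 0 = 0"
    using eigenvectors_independent[OF A _ theta_inj, of w 0] by simp
  with v(2) show False by (simp add: w_def)
qed

lemma F_Int_G: "F n \<inter> G n = {0}"
proof -
  have "span (\<Union>n. F n \<inter> G n) \<subseteq> G 1"
  proof (intro span_minimal subspace_G UN_least)
    fix n show "F n \<inter> G n \<subseteq> G 1"
      using F_0 G_antimono[of 1 n] subspace_0[OF subspace_G, of 1] by (cases "n = 0") auto
  qed
  then have "span (\<Union>n. F n \<inter> G n) = {0}"
    using span_F_Int_G[of 0] G_1_proper by auto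
  then have "F n \<inter> G n \<subseteq> {0}" using span_superset[of "\<Union>n. F n \<inter> G n"] by blast
  then show ?thesis using subspace_0 subspace_F subspace_G by blast
qed

definition W :: "nat \<Rightarrow> 'v set" where "W i = F (Suc i) \<inter> G i"

lemma subspace_W: "subspace (W i)"
  unfolding W_def by (intro subspace_inter subspace_F subspace_G)

lemma W_span: "subspace_sum scale W {..d} = UNIV"
proof -
  have "Vs 0 \<subseteq> F 1 \<inter> G 0" using Vs_subset_F[of 0 1] by (simp add: G_0)
  also have "\<dots> \<subseteq> span (\<Union>n. F (n + 1) \<inter> G n)" by (intro order.trans[OF _ span_superset]) auto
  finally have "span (\<Union>n. F (n + 1) \<inter> G n) \<noteq> {0}"
    using Vs_nonzero[of 0] Vs[of 0] subspace_0[OF subspace_eigenspace[OF As, of "\<theta>s 0"]] by auto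
  then have "span (\<Union>n. W n) = UNIV" using span_F_Int_G[of 1] by (simp add: W_def)
  moreover have "span (\<Union>n. W n) \<subseteq> subspace_sum scale W {..d}"
  proof (intro span_minimal subspace_subspace_sum UN_least)
    fix n show "W n \<subseteq> subspace_sum scale W {..d}"
    proof (cases "n \<le> d")
      case True
      then show ?thesis by (auto intro: subspace_sum_base)
    next
      case False
      then have "W n \<subseteq> {0}" using G_beyond[of n] by (auto simp: W_def)
      then show ?thesis using subspace_0[OF subspace_subspace_sum] by blast
    qed
  qed
  ultimately show ?thesis by auto
qed

text \<open>
  In a vanishing sum, the first nonzero term would lie in \<open>F (i + 1)\<close> and, being the negative of the sum
  of the later ones, also in \<open>G (i + 1)\<close>.
\<close>
lemma W_decomposition: "decomposition d W"
  unfolding decomposition_def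
proof (intro conjI allI impI subspace_W W_span)
  fix u i assume u: "\<forall>i\<le>d. u i \<in> W i" and sum: "(\<Sum>i\<le>d. u i) = 0" and i: "i \<le> d"
  from i show "u i = 0"
  proof (induction i rule: less_induct)
    case (less i)
    have "{..d} = {..<i} \<union> {i} \<union> {Suc i..d}" using less.prems by auto
    then have "(\<Sum>i\<le>d. u i) = (\<Sum>i\<in>{..<i} \<union> {i}. u i) + (\<Sum>i\<in>{Suc i..d}. u i)"
      by (simp only:) (intro sum.union_disjoint, auto)
    also have "(\<Sum>i\<in>{..<i} \<union> {i}. u i) = u i"
      using less by simp
    finally have "u i = - (\<Sum>i\<in>{Suc i..d}. u i)" using sum by (simp add: eq_neg_iff_add_eq_0)
    moreover have "(\<Sum>i\<in>{Suc i..d}. u i) \<in> G (Suc i)"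
      using u G_antimono by (intro subspace_sum subspace_G) (fastforce simp: W_def)
    ultimately have "u i \<in> G (Suc i)" by (simp add: subspace_neg subspace_G)
    then have "u i \<in> F (Suc i) \<inter> G (Suc i)" using u less.prems by (simp add: W_def)
    then show ?case using F_Int_G by simp
  qed
qed

text \<open>
  Write \<open>v \<in> G n\<close> as a sum over all \<open>W i\<close>. The part with \<open>i < n\<close> lies in \<open>F n\<close>, and in \<open>G n\<close> because
  the rest does, so it is zero.
\<close>
lemma G_eq_sum_W: "G n = subspace_sum scale W {n..d}"
proof
  have "W i \<subseteq> G n" if "i \<in> {n..d}" for i using that G_antimono[of n i] by (auto simp: W_def)
  then show "subspace_sum scale W {n..d} \<subseteq> G n"
    unfolding subspace_sum_def by (intro span_minimal subspace_G) blast
next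
  show "G n \<subseteq> subspace_sum scale W {n..d}"
  proof
    fix v assume v: "v \<in> G n"
    show "v \<in> subspace_sum scale W {n..d}"
    proof (cases "n \<le> d")
      case True
      obtain u where u: "\<And>i. i \<in> {..d} \<Longrightarrow> u i \<in> W i" "v = (\<Sum>i\<in>{..d}. u i)"
        using W_span subspace_W by (metis UNIV_I finite_atMost in_subspace_sumE)
      have tail: "(\<Sum>i\<in>{n..d}. u i) \<in> subspace_sum scale W {n..d}"
        using u(1) by (intro subspace_sum subspace_subspace_sum) (auto intro: subspace_sum_base)
      have "{..d} = {..<n} \<union> {n..d}" using True by auto
      then have split: "v = (\<Sum>i<n. u i) + (\<Sum>i\<in>{n..d}. u i)"
        unfolding u(2) by (simp only:) (intro sum.union_disjoint, auto)
      have "(\<Sum>i\<in>{n..d}. u i) \<in> G n"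
        using u(1) G_antimono by (intro subspace_sum subspace_G) (fastforce simp: W_def)
      then have "(\<Sum>i<n. u i) \<in> G n"
        using v split subspace_diff[OF subspace_G v] by (metis add_diff_cancel_right')
      moreover have "(\<Sum>i<n. u i) \<in> F n"
      proof (intro subspace_sum subspace_F)
        fix i assume "i \<in> {..<n}"
        then show "u i \<in> F n" using u(1)[of i] True F_mono[of "Suc i" n] by (auto simp: W_def)
      qed
      ultimately have "(\<Sum>i<n. u i) = 0" using F_Int_G[of n] by blast
      then show ?thesis using split tail by simp
    next
      case False
      then show ?thesis using v G_beyond[of n] subspace_0[OF subspace_subspace_sum] by simp
    qed
  qed
qed

lemma A_W:
  assumes "w \<in> W i" "i \<le> d"
  shows "A w - \<theta> i *s w \<in> W (Suc i)"
proof -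
  have "w \<in> F (Suc (Suc i))" using assms F_mono[of "Suc i" "Suc (Suc i)"] by (auto simp: W_def)
  then show ?thesis
    using assms A_F[of w "Suc i"] A_G[of w i]
    by (auto simp: W_def intro!: subspace_diff subspace_scale subspace_F)
qed

end

section \<open>The intertwining relation\<close>

context tridiagonal_system
begin

definition K :: "'v \<Rightarrow> 'v" where "K = corresponding_map scale q d W"

text \<open>
  The inverse of \<open>K\<close>, introduced by its eigenvalues so that it is linear and triangular for the same
  reason as \<open>K\<close>.
\<close>
definition Kinv :: "'v \<Rightarrow> 'v" where
  "Kinv = (THE X. endo X \<and> (\<forall>i\<le>d. \<forall>w\<in>W i. X w = inverse (\<kappa> i) *s w))"

lemma endo_K: "endo K" and K_W: "\<And>i w. i \<le> d \<Longrightarrow> w \<in> W i \<Longrightarrow> K w = \<kappa> i *s w"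
  using corresponding_map_spec[OF W_decomposition] by (simp_all add: K_def \<kappa>_def)

lemma endo_Kinv: "endo Kinv" and Kinv_W: "\<And>i w. i \<le> d \<Longrightarrow> w \<in> W i \<Longrightarrow> Kinv w = inverse (\<kappa> i) *s w"
  using theI'[OF decomposition_ex1_endo[OF W_decomposition, of "\<lambda>i. inverse (\<kappa> i)"]]
  unfolding Kinv_def[symmetric] by blast+

lemma endo_eq_on_W:
  assumes "endo f" "endo g" "\<And>i w. i \<le> d \<Longrightarrow> w \<in> W i \<Longrightarrow> f w = g w"
  shows "f v = g v"
  by (rule endo_eq_on_subspace_sum[of f g "{..d}" W]) (simp_all add: assms W_span)

lemma endo_eq_on_V:
  assumes "endo f" "endo g" "\<And>i w. i \<le> d \<Longrightarrow> w \<in> V i \<Longrightarrow> f w = g w"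
  shows "f v = g v"
  by (rule endo_eq_on_subspace_sum[of f g "{..d}" V]) (simp_all add: assms V_span)

lemmas hom_simps = endo_add[OF A] endo_scale[OF A] endo_diff[OF A]
  endo_add[OF endo_K] endo_scale[OF endo_K] endo_diff[OF endo_K]
  endo_add[OF endo_Kinv] endo_scale[OF endo_Kinv] endo_diff[OF endo_Kinv]

lemma K_Kinv: "K (Kinv v) = v"
proof (rule endo_eq_on_W[of "\<lambda>v. K (Kinv v)" "\<lambda>v. v"])
  fix i w assume "i \<le> d" "w \<in> W i"
  then show "K (Kinv w) = w" by (simp add: K_W Kinv_W[of i] endo_scale[OF endo_K] K_W[of i] kappa_nonzero)
qed (simp_all add: endo_iff hom_simps algebra_simps)

lemma Kinv_K: "Kinv (K v) = v"
proof (rule endo_eq_on_W[of "\<lambda>v. Kinv (K v)" "\<lambda>v. v"])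
  fix i w assume "i \<le> d" "w \<in> W i"
  then show "Kinv (K w) = w" by (simp add: K_W[of i] endo_scale[OF endo_Kinv] Kinv_W[of i] kappa_nonzero)
qed (simp_all add: endo_iff hom_simps algebra_simps)

lemma inv_K: "inv_into UNIV K v = Kinv v"
proof -
  have "inj K" by (rule inj_on_inverseI[of _ Kinv]) (rule Kinv_K)
  then have "inv_into UNIV K (K (Kinv v)) = Kinv v" by (rule inv_f_f)
  then show ?thesis by (simp add: K_Kinv)
qed

text \<open>
  The flag \<open>G\<close> is generated both by the eigenspaces of \<open>A\<close> and by the summands \<open>W i\<close>; an operator that
  is diagonal for either family is therefore triangular for the flag. This is how \<open>K\<close> and \<open>H\<close>, which are
  diagonal in different decompositions, are compared.
\<close>
lemma flag_triangular:
  assumes X: "endo X" and XU: "\<And>i w. i \<le> d \<Longrightarrow> w \<in> U i \<Longrightarrow> X w = c i *s w"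
    and U: "\<And>n. G n = subspace_sum scale U {n..d}"
    and v: "v \<in> G n"
  shows "X v - c n *s v \<in> G (Suc n)"
proof (rule endo_subspace_sum[OF endo_minus_scalar[OF X] subspace_G _ v[unfolded U]])
  fix i w assume i: "i \<in> {n..d}" and w: "w \<in> U i"
  then have "X w - c n *s w = (c i - c n) *s w"
    using XU by (simp add: scale_left_diff_distrib)
  moreover have "w \<in> G (Suc n)" if "i \<noteq> n"
    using i w that unfolding U by (intro subspace_sum_base) auto
  ultimately show "X w - c n *s w \<in> G (Suc n)"
    by (cases "i = n") (simp_all add: subspace_0 subspace_scale subspace_G)
qed

lemma K_G: "v \<in> G n \<Longrightarrow> K v - \<kappa> n *s v \<in> G (Suc n)"
  and Kinv_G: "v \<in> G n \<Longrightarrow> Kinv v - inverse (\<kappa> n) *s v \<in> G (Suc n)"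
  by (rule flag_triangular[OF endo_K K_W G_eq_sum_W], assumption+)
     (rule flag_triangular[OF endo_Kinv Kinv_W G_eq_sum_W], assumption+)

text \<open>
  The map that \<open>H\<^sup>-\<^sup>1 K H\<close> will turn out to be.
\<close>
definition K' :: "'v \<Rightarrow> 'v" where
  "K' v = inverse a *s A v - (inverse a)\<^sup>2 *s Kinv v"

lemma endo_K': "endo K'"
  by (simp add: K'_def endo_iff hom_simps algebra_simps)

lemma A_decompose: "A v = a *s K' v + inverse a *s Kinv v"
  using a0 by (simp add: K'_def scale_right_diff_distrib power2_eq_square)

text \<open>
  The vector \<open>r\<close> lies in \<open>W (i + 1)\<close>. When \<open>i = d\<close> it is zero, so the two eigenvector equations hold
  in this case as well.
\<close>
lemma W_raise:
  assumes "i \<le> d" "w \<in> W i"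
  obtains r where "A w = \<theta> i *s w + r" "K r = \<kappa> (Suc i) *s r" "Kinv r = inverse (\<kappa> (Suc i)) *s r"
proof (rule that[of "A w - \<theta> i *s w"])
  let ?r = "A w - \<theta> i *s w"
  have r: "?r \<in> W (Suc i)" using A_W assms by simp
  have "?r = 0" if "\<not> Suc i \<le> d" using r that G_beyond[of "Suc i"] by (simp add: W_def)
  then show "K ?r = \<kappa> (Suc i) *s ?r" "Kinv ?r = inverse (\<kappa> (Suc i)) *s ?r"
    using r K_W[of "Suc i" ?r] Kinv_W[of "Suc i" ?r] endo_zero[OF endo_K] endo_zero[OF endo_Kinv]
    by (cases "Suc i \<le> d"; simp)+
qed simp

text \<open>
  On \<open>W i\<close> the component in \<open>W (i + 1)\<close> cancels because \<open>\<kappa> i = q\<^sup>2 \<kappa> (i + 1)\<close>.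
\<close>
lemma K_A_relation:
  "q *s K (A v) - inverse q *s A (K v) = (q - inverse q) *s (inverse a *s v + a *s K (K v))"
proof (rule endo_eq_on_W[of "\<lambda>v. q *s K (A v) - inverse q *s A (K v)"
      "\<lambda>v. (q - inverse q) *s (inverse a *s v + a *s K (K v))"])
  fix i w assume i: "i \<le> d" and w: "w \<in> W i"
  obtain r where r: "A w = \<theta> i *s w + r" "K r = \<kappa> (Suc i) *s r"
    by (rule W_raise[OF i w])
  have "q *s K (A w) - inverse q *s A (K w)
      = ((q - inverse q) * \<theta> i * \<kappa> i) *s w + (q * \<kappa> (Suc i) - inverse q * \<kappa> i) *s r"
    using i w r by (simp add: K_W[of i] endo_add[OF endo_K] endo_scale[OF endo_K] endo_scale[OF A]
        scale_right_distrib scale_left_diff_distrib algebra_simps)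
  also have "q * \<kappa> (Suc i) - inverse q * \<kappa> i = 0"
    using q0 by (simp add: kappa_Suc[of i] power2_eq_square)
  also have "(q - inverse q) * \<theta> i * \<kappa> i = (q - inverse q) * (inverse a + a * \<kappa> i * \<kappa> i)"
    using i a0 kappa_nonzero[of i] by (simp add: theta_kappa field_simps)
  finally show "q *s K (A w) - inverse q *s A (K w)
      = (q - inverse q) *s (inverse a *s w + a *s K (K w))"
    using i w by (simp add: K_W[of i] endo_scale[OF endo_K] scale_left_distrib[symmetric] mult.assoc)
qed (simp_all add: endo_iff hom_simps algebra_simps)

text \<open>
  Here \<open>K' = K + a\<^sup>-\<^sup>1 R\<close>, and the part with the raising map \<open>R\<close> cancels because
  \<open>q R K\<^sup>-\<^sup>1 = q\<^sup>-\<^sup>1 K\<^sup>-\<^sup>1 R\<close>.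
\<close>
lemma K'_Kinv_relation: "q *s K' (Kinv v) - inverse q *s Kinv (K' v) = (q - inverse q) *s v"
proof (rule endo_eq_on_W[of "\<lambda>v. q *s K' (Kinv v) - inverse q *s Kinv (K' v)" "\<lambda>v. (q - inverse q) *s v"])
  fix i w assume i: "i \<le> d" and w: "w \<in> W i"
  obtain r where r: "A w = \<theta> i *s w + r" "Kinv r = inverse (\<kappa> (Suc i)) *s r"
    by (rule W_raise[OF i w])
  have "inverse a * \<theta> i - (inverse a)\<^sup>2 * inverse (\<kappa> i) = \<kappa> i"
    using i a0 by (simp add: theta_kappa field_simps power2_eq_square)
  moreover have "K' w = (inverse a * \<theta> i - (inverse a)\<^sup>2 * inverse (\<kappa> i)) *s w + inverse a *s r"
    using i w r by (simp add: K'_def Kinv_W[of i] scale_right_distrib scale_left_diff_distrib)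
  ultimately have K'w: "K' w = \<kappa> i *s w + inverse a *s r" by simp
  have "q *s K' (Kinv w) - inverse q *s Kinv (K' w)
      = (q - inverse q) *s w + (inverse a * (q * inverse (\<kappa> i) - inverse q * inverse (\<kappa> (Suc i)))) *s r"
    using i w r(2) K'w kappa_nonzero[of i]
    by (simp add: Kinv_W[of i] endo_add[OF endo_Kinv] endo_scale[OF endo_Kinv] endo_scale[OF endo_K']
        scale_right_distrib scale_left_diff_distrib algebra_simps)
  also have "q * inverse (\<kappa> i) - inverse q * inverse (\<kappa> (Suc i)) = 0"
    using q0 kappa_nonzero[of "Suc i"] by (simp add: kappa_Suc[of i] field_simps power2_eq_square)
  finally show "q *s K' (Kinv w) - inverse q *s Kinv (K' w) = (q - inverse q) *s w" by simp
qed (simp_all add: endo_iff hom_simps endo_add[OF endo_K'] endo_scale[OF endo_K'] algebra_simps)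

text \<open>
  Substituting \<open>A = a K' + a\<^sup>-\<^sup>1 K\<^sup>-\<^sup>1\<close> reduces this to the relation between \<open>K'\<close> and \<open>K\<^sup>-\<^sup>1\<close>.
\<close>
lemma K'_A_relation:
  "q *s K' (A v) - inverse q *s A (K' v) = (q - inverse q) *s (inverse a *s v + a *s K' (K' v))"
proof -
  have "q *s K' (A v) - inverse q *s A (K' v)
      = (q - inverse q) *s a *s K' (K' v) + inverse a *s (q *s K' (Kinv v) - inverse q *s Kinv (K' v))"
    by (simp add: A_decompose[of v] A_decompose[of "K' v"] endo_add[OF endo_K'] endo_scale[OF endo_K'] scale_right_distrib
        scale_right_diff_distrib scale_left_diff_distrib algebra_simps)
  then show ?thesis
    by (simp add: K'_Kinv_relation scale_right_distrib add.commute mult.commute)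
qed

text \<open>
  Up to a nonzero factor this is \<open>(\<kappa> i - q\<^sup>2 \<kappa> (i + m)) (a\<^sup>2 \<kappa> i \<kappa> (i + m) - 1)\<close>. It vanishes for
  \<open>m = 1\<close>, which is why the blocks next to the diagonal have to be matched separately.
\<close>
lemma intertwining_coefficient_nonzero:
  assumes "m \<ge> 2" "i + m \<le> d"
  shows "q * \<theta> i - inverse q * \<theta> (i + m) - (q - inverse q) * a * (\<kappa> i + \<kappa> (i + m)) \<noteq> 0"
proof -
  let ?x = "\<kappa> i" and ?y = "\<kappa> (i + m)"
  have ne: "a\<^sup>2 * ?x * ?y \<noteq> 1" using kappa_product_noneq[of i "i + m"] assms by simp
  have "q ^ (2 * m) \<noteq> q\<^sup>2"
  proof
    assume "q ^ (2 * m) = q\<^sup>2"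
    moreover have "q ^ (2 * m) = q ^ (2 + (2 * m - 2))"
      by (rule arg_cong[where f = "\<lambda>n. q ^ n"]) (use assms in simp)
    then have "q ^ (2 * m) = q\<^sup>2 * q ^ (2 * m - 2)"
      by (simp only: power_add)
    ultimately have "q ^ (2 * m - 2) = 1" using q0 by simp
    with q_power[of "2 * m - 2"] assms show False by simp
  qed
  then have "?x \<noteq> q\<^sup>2 * ?y"
    using kappa_nonzero[of "i + m"] kappa_add[of i m] by simp
  then have "(?x - q\<^sup>2 * ?y) * (a\<^sup>2 * ?x * ?y - 1) \<noteq> 0" using ne by simp
  moreover have "(q * a * ?x * ?y) * (q * \<theta> i - inverse q * \<theta> (i + m)
      - (q - inverse q) * a * (?x + ?y)) = (?x - q\<^sup>2 * ?y) * (a\<^sup>2 * ?x * ?y - 1)"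
    using assms q0 a0 kappa_nonzero[of i] kappa_nonzero[of "i + m"]
    by (simp add: theta_kappa field_simps power2_eq_square)
  ultimately show ?thesis by auto
qed

text \<open>
  The defect \<open>D = H K' - K H\<close> satisfies the linear relation
  \<open>q D A - q\<^sup>-\<^sup>1 A D = (q - q\<^sup>-\<^sup>1) a (D K' + K D)\<close>. If \<open>D\<close> maps each \<open>V i\<close> into \<open>G (i + m)\<close>, this relation
  modulo \<open>G (i + m + 1)\<close> multiplies \<open>D v\<close> by a nonzero scalar and gives zero, so \<open>m\<close> can be increased
  until \<open>D = 0\<close>. The recursion for \<open>t\<close> provides the start \<open>m = 2\<close>.
\<close>
theorem K_intertwining:
  assumes H: "endo H" and H_V: "\<And>i v. i \<le> d \<Longrightarrow> v \<in> V i \<Longrightarrow> H v = t i *s v"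
    and t_Suc: "\<And>i. Suc i \<le> d \<Longrightarrow> t (Suc i) = a\<^sup>2 * \<kappa> i * \<kappa> (Suc i) * t i"
  shows "H (K' v) = K (H v)"
proof -
  define D where "D v = H (K' v) - K (H v)" for v
  have D: "endo D" 
    by (simp add: D_def endo_iff hom_simps endo_add[OF endo_K'] endo_scale[OF endo_K']
        endo_add[OF H] endo_scale[OF H] algebra_simps)
  have AH: "A (H v) = H (A v)" for v
  proof (rule endo_eq_on_V[of "\<lambda>v. A (H v)" "\<lambda>v. H (A v)"])
    show "A (H w) = H (A w)" if "i \<le> d" "w \<in> V i" for i w
      using that by (simp add: H_V[of i] A_eigen[of i] endo_scale[OF A] endo_scale[OF H] mult.commute)
  qed (simp_all add: endo_iff hom_simps endo_add[OF H] endo_scale[OF H])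
  have HG: "H v - t n *s v \<in> G (Suc n)" if "v \<in> G n" for v n
    using flag_triangular[OF H H_V G_def that] .
  have D_relation: "q *s D (A v) - inverse q *s A (D v)
      = ((q - inverse q) * a) *s (D (K' v) + K (D v))" for v
  proof -
    have "q *s D (A v) - inverse q *s A (D v)
        = H (q *s K' (A v) - inverse q *s A (K' v)) - (q *s K (A (H v)) - inverse q *s A (K (H v)))"
      by (simp add: D_def AH hom_simps endo_diff[OF H] endo_scale[OF H] algebra_simps)
    also have "\<dots> = H ((q - inverse q) *s (inverse a *s v + a *s K' (K' v)))
        - (q - inverse q) *s (inverse a *s H v + a *s K (K (H v)))"
      by (simp only: K_A_relation K'_A_relation)
    also have "\<dots> = ((q - inverse q) * a) *s (D (K' v) + K (D v))"
      by (simp add: D_def hom_simps endo_add[OF H] endo_diff[OF H] endo_scale[OF H] algebra_simps)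
    finally show ?thesis .
  qed
  have D_G: "D v \<in> G (n + m)" if "\<And>i w. i \<le> d \<Longrightarrow> w \<in> V i \<Longrightarrow> D w \<in> G (i + m)" "v \<in> G n" for v n m
  proof (rule endo_subspace_sum[OF D subspace_G _ that(2)[unfolded G_def]])
    fix i w assume "i \<in> {n..d}" "w \<in> V i"
    then show "D w \<in> G (n + m)" using that(1)[of i w] G_antimono[of "n + m" "i + m"] by auto
  qed
  \<comment> \<open>The off-diagonal blocks of \<open>K\<close> and its inverse differ by the factor \<open>- 1 / (\<kappa> i \<kappa> (i + 1))\<close>.\<close>
  have D_two: "D v \<in> G (i + 2)" if i: "i \<le> d" and v: "v \<in> V i" for i v
  proof -
    have vG: "v \<in> G i" using i v V_subset_G by blast
    define g where "g = K v - \<kappa> i *s v"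
    have g: "g \<in> G (Suc i)" unfolding g_def using K_G vG .
    define x where "x = Kinv g - inverse (\<kappa> (Suc i)) *s g"
    define y where "y = H g - t (Suc i) *s g"
    have x: "x \<in> G (i + 2)" using Kinv_G[OF g] by (simp add: x_def)
    have y: "y \<in> G (i + 2)" using HG[OF g] by (simp add: y_def)
    have "H x - t (i + 2) *s x \<in> G (i + 2)"
      using HG[OF x] G_antimono[of "i + 2" "Suc (i + 2)"] by auto
    from subspace_add[OF subspace_G this subspace_scale[OF subspace_G x, of "t (i + 2)"]]
    have Hx: "H x \<in> G (i + 2)" by simp
    have "v = Kinv (K v)" by (simp add: Kinv_K)
    also have "\<dots> = \<kappa> i *s Kinv v + Kinv g"
      by (simp add: g_def endo_diff[OF endo_Kinv] endo_scale[OF endo_Kinv])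
    finally have "v - Kinv g = \<kappa> i *s Kinv v" by (simp add: diff_eq_eq)
    then have Lv: "Kinv v = inverse (\<kappa> i) *s (v - Kinv g)"
      using kappa_nonzero[of i] by simp
    have "inverse a * \<theta> i - (inverse a)\<^sup>2 * inverse (\<kappa> i) = \<kappa> i"
      using i a0 by (simp add: theta_kappa field_simps power2_eq_square)
    moreover have "K' v = (inverse a * \<theta> i - (inverse a)\<^sup>2 * inverse (\<kappa> i)) *s v
        + ((inverse a)\<^sup>2 * inverse (\<kappa> i)) *s Kinv g"
      using A_eigen[OF i v]
      by (simp add: K'_def Lv scale_right_diff_distrib scale_left_diff_distrib)
    ultimately have K'v: "K' v = \<kappa> i *s v + ((inverse a)\<^sup>2 * inverse (\<kappa> i)) *s Kinv g" by simp
    \<comment> \<open>The block of the defect next to the diagonal; the recursion for \<open>t\<close> makes it vanish.\<close>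
    let ?e = "(inverse a)\<^sup>2 * inverse (\<kappa> i) * inverse (\<kappa> (Suc i)) * t (Suc i) - t i"
    have "Kinv g = inverse (\<kappa> (Suc i)) *s g + x" by (simp add: x_def)
    moreover have "H g = t (Suc i) *s g + y" by (simp add: y_def)
    moreover have "K v = \<kappa> i *s v + g" by (simp add: g_def)
    ultimately have "D v = ?e *s g
        + ((inverse a)\<^sup>2 * inverse (\<kappa> i)) *s (inverse (\<kappa> (Suc i)) *s y + H x)"
      using H_V[OF i v] K'v
      by (simp add: D_def endo_add[OF H] endo_scale[OF H] endo_scale[OF endo_K]
          scale_right_distrib scale_left_diff_distrib algebra_simps)
    moreover have "?e *s g = 0"
    proof (cases "Suc i \<le> d")
      case True
      then have "?e = 0"
        using a0 kappa_nonzero[of i] kappa_nonzero[of "Suc i"]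
        by (simp add: t_Suc field_simps power2_eq_square)
      then show ?thesis by simp
    next
      case False
      then show ?thesis using g G_beyond[of "Suc i"] by simp
    qed
    ultimately show ?thesis
      using x y Hx by (simp add: subspace_add subspace_scale subspace_G)
  qed
  have D_V: "D v \<in> G (i + m)" if "m \<ge> 2" "i \<le> d" "v \<in> V i" for m i v
    using that
  proof (induction m arbitrary: i v rule: dec_induct)
    case base
    then show ?case by (rule D_two)
  next
    case (step m)
    note i = step.prems(1) and v = step.prems(2)
    let ?w = "D v" and ?c = "(q - inverse q) * a"
    have w: "?w \<in> G (i + m)" using step.IH i v .
    show ?case
    proof (cases "i + m \<le> d")
      case False
      then show ?thesis using w G_beyond[of "i + m"] G_beyond[of "i + Suc m"] by simp
    next
      case True
      let ?G = "G (i + Suc m)"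
      have vG: "v \<in> G i" using i v V_subset_G by blast
      have th: "inverse a * \<theta> i = \<kappa> i + (inverse a)\<^sup>2 * inverse (\<kappa> i)"
        using i a0 by (simp add: theta_kappa field_simps power2_eq_square)
      have "K' v - \<kappa> i *s v = (inverse a)\<^sup>2 *s (inverse (\<kappa> i) *s v - Kinv v)"
        unfolding K'_def A_eigen[OF i v] scale_scale th scale_right_diff_distrib scale_left_distrib
        by simp
      moreover have "inverse (\<kappa> i) *s v - Kinv v \<in> G (Suc i)"
        using subspace_neg[OF subspace_G Kinv_G[OF vG]] by simp
      ultimately have "K' v - \<kappa> i *s v \<in> G (Suc i)"
        by (simp add: subspace_scale subspace_G)
      then have 1: "D (K' v - \<kappa> i *s v) \<in> ?G"
        using D_G[OF step.IH] by fastforce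
      have 2: "A ?w - \<theta> (i + m) *s ?w \<in> ?G" "K ?w - \<kappa> (i + m) *s ?w \<in> ?G"
        using A_G[OF w] K_G[OF w] by simp_all
      have "(q * \<theta> i - inverse q * \<theta> (i + m) - ?c * (\<kappa> i + \<kappa> (i + m))) *s ?w
        = inverse q *s (A ?w - \<theta> (i + m) *s ?w)
          + ?c *s (D (K' v - \<kappa> i *s v) + (K ?w - \<kappa> (i + m) *s ?w))"
        using D_relation[of v] i v 
        by (simp add: A_eigen[of i] endo_diff[OF D] endo_scale[OF D] scale_right_distrib
          scale_right_diff_distrib scale_left_diff_distrib scale_left_distrib algebra_simps)
      also have "\<dots> \<in> ?G"
        using 1 2 by (intro subspace_add subspace_scale subspace_G)
      finally have "inverse (q * \<theta> i - inverse q * \<theta> (i + m) - ?c * (\<kappa> i + \<kappa> (i + m))) *s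
        (q * \<theta> i - inverse q * \<theta> (i + m) - ?c * (\<kappa> i + \<kappa> (i + m))) *s ?w \<in> ?G"
        by (rule subspace_scale[OF subspace_G])
      then show ?thesis
        using intertwining_coefficient_nonzero[OF step.hyps(1) True] by simp
    qed
  qed
  have "D v = 0"
  proof (rule endo_eq_on_V[OF D, of "\<lambda>_. 0"])
    show "endo (\<lambda>_. 0)" by (simp add: endo_iff)
    show "D w = 0" if "i \<le> d" "w \<in> V i" for i w
      using D_V[of "d + 2" i w] that G_beyond[of "i + (d + 2)"] by simp
  qed
  then show ?thesis by (simp add: D_def)
qed

lemma V_decomposition: "decomposition d V"
proof -
  have "subspace_sum scale (\<lambda>i. eigenspace scale A (\<theta> i)) {..d} = subspace_sum scale V {..d}"
    unfolding subspace_sum_def using V by simp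
  then have "decomposition d (\<lambda>i. eigenspace scale A (\<theta> i))"
    using V_span by (intro decomposition_eigenspaces A theta_inj) simp
  then show ?thesis
    unfolding decomposition_def subspace_sum_def using V by simp
qed

theorem K_conjugate:
  assumes H: "endo H" and H_V: "\<And>i v. i \<le> d \<Longrightarrow> v \<in> V i \<Longrightarrow> H v = t i *s v"
    and t_Suc: "\<And>i. Suc i \<le> d \<Longrightarrow> t (Suc i) = a\<^sup>2 * \<kappa> i * \<kappa> (Suc i) * t i"
    and t_nonzero: "\<And>i. i \<le> d \<Longrightarrow> t i \<noteq> 0"
  defines "X \<equiv> corresponding_map scale q d
      (\<lambda>i. subspace_sum scale Vs {..i} \<inter> subspace_sum scale V {i..d})"
  shows "inv_into UNIV H \<circ> X \<circ> H
    = (\<lambda>v. inverse a *s A v - (inverse a)\<^sup>2 *s inv_into UNIV X v)"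
proof
  fix v
  have X: "X = K"
    by (simp add: X_def K_def W_def[abs_def] F_def G_def lessThan_Suc_atMost)
  obtain H' where H': "endo H'" "\<And>i w. i \<le> d \<Longrightarrow> w \<in> V i \<Longrightarrow> H' w = inverse (t i) *s w"
    using decomposition_ex1_endo[OF V_decomposition, of "\<lambda>i. inverse (t i)"] by blast
  have "H' (H w) = w" for w
  proof (rule endo_eq_on_V[of "\<lambda>w. H' (H w)" "\<lambda>w. w"])
    fix i w assume "i \<le> d" "w \<in> V i"
    then show "H' (H w) = w"
      by (simp add: H_V[of i] H'(2)[of i] endo_scale[OF H'(1)] t_nonzero)
  qed (simp_all add: endo_iff endo_add[OF H] endo_scale[OF H] endo_add[OF H'(1)] endo_scale[OF H'(1)])
  then have "inj H" by (rule inj_on_inverseI)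
  then have "inv_into UNIV H (H (K' v)) = K' v" by (rule inv_f_f)
  then show "(inv_into UNIV H \<circ> X \<circ> H) v = inverse a *s A v - (inverse a)\<^sup>2 *s inv_into UNIV X v"
    using K_intertwining[OF H H_V t_Suc] by (simp add: X K'_def inv_K)
qed

end

section \<open>Reversing the orderings of the eigenspaces\<close>

lemma neighbours_reverse:
  fixes i d :: nat
  assumes "i \<le> d"
  shows "(\<lambda>j. d - j) ` {j. j \<le> d \<and> i \<le> j + 1 \<and> j \<le> i + 1}
    = {j. j \<le> d \<and> d - i \<le> j + 1 \<and> j \<le> d - i + 1}"
proof
  show "{j. j \<le> d \<and> d - i \<le> j + 1 \<and> j \<le> d - i + 1}
      \<subseteq> (\<lambda>j. d - j) ` {j. j \<le> d \<and> i \<le> j + 1 \<and> j \<le> i + 1}"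
    using assms by (auto intro!: image_eqI[of x _ "d - x" for x])
qed (use assms in auto)

lemma image_diff_atMost: "(\<lambda>i. d - i) ` {..d} = {..d}" for d :: nat
  by (auto intro!: image_eqI[of x _ "d - x" for x])

lemma image_diff_atMost_le: "i \<le> d \<Longrightarrow> (\<lambda>i. d - i) ` {..i} = {d - i..d}" for d :: nat
  by (auto intro!: image_eqI[of x _ "d - x" for x])

lemma image_diff_atLeastAtMost: "i \<le> d \<Longrightarrow> (\<lambda>i. d - i) ` {i..d} = {..d - i}" for d :: nat
  by (auto intro!: image_eqI[of x _ "d - x" for x])

context tridiagonal_system
begin

lemma reverse_Vs:
  "tridiagonal_system scale q a d \<theta> A As (\<lambda>i. \<theta>s (d - i)) V (\<lambda>i. Vs (d - i))"
proof (intro tridiagonal_system.intro tridiagonal_system_axioms.intro endomorphisms_axioms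
    q_Racah_spectrum_axioms)
  fix i assume i: "i \<le> d"
  then have "A ` Vs (d - i) \<subseteq> subspace_sum scale Vs {j. j \<le> d \<and> d - i \<le> j + 1 \<and> j \<le> d - i + 1}"
    by (intro A_Vs) simp
  then show "A ` Vs (d - i) \<subseteq> subspace_sum scale (\<lambda>i. Vs (d - i)) {j. j \<le> d \<and> i \<le> j + 1 \<and> j \<le> i + 1}"
    unfolding subspace_sum_reverse neighbours_reverse[OF i] .
qed (rule A As V_span | (rule V V_nonzero As_V irreducible, assumption+) | (rule Vs Vs_nonzero, simp))+

text \<open>
  Since \<open>\<kappa> (d - i) = 1 / \<kappa> i\<close>, reading \<open>\<theta>\<close> backwards exchanges the roles of \<open>a\<close> and its inverse.
\<close>
lemma reverse_V:
  "tridiagonal_system scale q (inverse a) d (\<lambda>i. \<theta> (d - i)) A As \<theta>s (\<lambda>i. V (d - i)) Vs"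
proof (intro tridiagonal_system.intro tridiagonal_system_axioms.intro endomorphisms_axioms
    q_Racah_spectrum.intro)
  fix i assume i: "i \<le> d"
  then have "As ` V (d - i) \<subseteq> subspace_sum scale V {j. j \<le> d \<and> d - i \<le> j + 1 \<and> j \<le> d - i + 1}"
    by (intro As_V) simp
  then show "As ` V (d - i) \<subseteq> subspace_sum scale (\<lambda>i. V (d - i)) {j. j \<le> d \<and> i \<le> j + 1 \<and> j \<le> i + 1}"
    unfolding subspace_sum_reverse neighbours_reverse[OF i] .
next
  fix i assume "i \<le> d"
  then show "\<theta> (d - i) = inverse a * q powi (int d - 2 * int i)
      + inverse (inverse a) * q powi (2 * int i - int d)"
    by (simp add: theta of_nat_diff algebra_simps)
next
  show "inj_on (\<lambda>i. \<theta> (d - i)) {..d}"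
    by (rule inj_onI) (use inj_on_eq_iff[OF theta_inj] in force)
next
  show "subspace_sum scale (\<lambda>i. V (d - i)) {..d} = UNIV"
    unfolding subspace_sum_reverse image_diff_atMost by (rule V_span)
qed (rule A As | (rule Vs Vs_nonzero A_Vs irreducible, assumption+) | (rule V V_nonzero, simp) | simp add: q0 q_power a0)+

text \<open>
  The recursion factor for \<open>a\<close> at \<open>d - i - 1\<close> is the inverse of the factor for \<open>a\<^sup>-\<^sup>1\<close> at \<open>i\<close>,
  since \<open>\<kappa> (d - i) = 1 / \<kappa> i\<close>. So the coefficients of \<open>H\<close>, read backwards, solve the recursion for the
  inverse of \<open>a\<close>. Their first value need not be 1, hence the homogeneous form of the hypotheses in
  \<open>K_conjugate\<close>.
\<close>
lemma t_reverse:
  assumes t_Suc: "\<And>i. Suc i \<le> d \<Longrightarrow> t (Suc i) = a\<^sup>2 * \<kappa> i * \<kappa> (Suc i) * t i"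
    and i: "Suc i \<le> d"
  shows "t (d - Suc i) = (inverse a)\<^sup>2 * \<kappa> i * \<kappa> (Suc i) * t (d - i)"
proof -
  have "Suc (d - Suc i) = d - i" using i by simp
  then have "t (d - i) = a\<^sup>2 * \<kappa> (d - Suc i) * \<kappa> (d - i) * t (d - Suc i)"
    using t_Suc[of "d - Suc i"] i by simp
  also have "\<dots> = a\<^sup>2 * inverse (\<kappa> (Suc i)) * inverse (\<kappa> i) * t (d - Suc i)"
    using i by (simp add: kappa_reverse)
  finally show ?thesis
    using a0 kappa_nonzero[of i] kappa_nonzero[of "Suc i"] by (simp add: field_simps)
qed

end

section \<open>Modules of the q-Onsager algebra\<close>

lemma ring_free_ring: "ring (free_ring :: ('f::field) free_alg ring)"
proof (rule ringI)
  show "abelian_group (free_ring :: 'f free_alg ring)"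
    by (rule abelian_groupI) (auto simp: free_ring_def intro: exI[of _ "- x" for x] add.assoc add.commute)
  show "monoid (free_ring :: 'f free_alg ring)"
    by (rule monoidI) (auto simp: free_ring_def mult.assoc)
qed (auto simp: free_ring_def distrib_left distrib_right)

lemma ideal_q_Onsager_ideal: "ideal (q_Onsager_ideal q) free_ring"
  unfolding q_Onsager_ideal_def
  by (intro ring.genideal_ideal ring_free_ring) (simp add: free_ring_def)

lemma q_Onsager_class_hom: "q_Onsager_class q \<in> ring_hom free_ring (q_Onsager q)"
  unfolding q_Onsager_class_def[abs_def] q_Onsager_def
  by (rule ideal.rcos_ring_hom[OF ideal_q_Onsager_ideal])

lemma q_Onsager_class_carrier: "q_Onsager_class q x \<in> carrier (q_Onsager q)"
  and q_Onsager_class_add: "q_Onsager_class q (x + y)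
        = q_Onsager_class q x \<oplus>\<^bsub>q_Onsager q\<^esub> q_Onsager_class q y"
  and q_Onsager_class_mult: "q_Onsager_class q (x * y)
        = q_Onsager_class q x \<otimes>\<^bsub>q_Onsager q\<^esub> q_Onsager_class q y"
  using q_Onsager_class_hom[of q] by (auto simp: ring_hom_def free_ring_def)

lemma q_Onsager_carrierE:
  assumes "X \<in> carrier (q_Onsager q)"
  obtains x where "X = q_Onsager_class q x"
  using assms
  by (auto simp: q_Onsager_def FactRing_def A_RCOSETS_def' q_Onsager_class_def free_ring_def)

lemma q_Onsager_class_relator:
  fixes q :: "'f::field"
  shows "q_Onsager_class q (q_Onsager_relator q (free_gen Letter_A) (free_gen Letter_As))
    = q_Onsager_class q 0"
proof -
  interpret I: ideal "q_Onsager_ideal q" free_ring by (rule ideal_q_Onsager_ideal)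
  have "q_Onsager_relator q (free_gen Letter_A) (free_gen Letter_As) \<in> q_Onsager_ideal q"
    using ring.genideal_self[OF ring_free_ring,
        of "{q_Onsager_relator q (free_gen Letter_A) (free_gen Letter_As),
             q_Onsager_relator q (free_gen Letter_As) (free_gen Letter_A)}"]
    by (simp add: q_Onsager_ideal_def free_ring_def)
  moreover have "(0 :: 'f free_alg) \<in> q_Onsager_ideal q"
    using additive_subgroup.zero_closed[OF I.additive_subgroup_axioms] by (simp add: free_ring_def)
  ultimately show ?thesis by (simp add: q_Onsager_class_def I.a_rcos_const)
qed

locale q_Onsager_module = endomorphisms scale
  for scale :: "'f::field \<Rightarrow> 'v::ab_group_add \<Rightarrow> 'v" (infixr \<open>*s\<close> 75) +
  fixes q :: 'f and \<rho> :: "'f free_alg set \<Rightarrow> 'v \<Rightarrow> 'v"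
  assumes module_q_Onsager: "algebra_module scale (q_Onsager q) (q_Onsager_scalar q) \<rho>"
begin

definition rep :: "'f free_alg \<Rightarrow> 'v \<Rightarrow> 'v" where "rep x = \<rho> (q_Onsager_class q x)"

lemma endo_rep: "endo (rep x)"
  and rep_add: "rep (x + y) v = rep x v + rep y v"
  and rep_mult: "rep (x * y) v = rep x (rep y v)"
  and rep_scalar: "rep (free_scalar c) v = c *s v"
  using module_q_Onsager unfolding algebra_module_def
  by (auto simp: rep_def q_Onsager_class_carrier q_Onsager_class_add q_Onsager_class_mult
      q_Onsager_scalar_def)

lemma rep_zero: "rep 0 v = 0"
  using rep_add[of 0 0 v] by simp

lemma rep_diff: "rep (x - y) v = rep x v - rep y v"
  using rep_add[of "x - y" y v] by (simp add: algebra_simps)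

lemma rep_one: "rep 1 v = v"
  using rep_scalar[of 1 v] by (simp add: free_scalar_def)

abbreviation "A \<equiv> rep (free_gen Letter_A)"
abbreviation "As \<equiv> rep (free_gen Letter_As)"

text \<open>
  Every element of the free algebra is a linear combination of words, and a word acts as a composition of
  the two generators.
\<close>
lemma rep_invariant:
  assumes W: "subspace W" and gens: "A ` W \<subseteq> W" "As ` W \<subseteq> W" and w: "w \<in> W"
  shows "rep x w \<in> W"
proof -
  have words: "rep (Poly_Mapping.single (Word ls) 1) w \<in> W" if "w \<in> W" for ls w
    using that
  proof (induction ls)
    case Nil
    have "Poly_Mapping.single (Word []) 1 = (1 :: 'f free_alg)"
      unfolding zero_word_def[symmetric] by simp
    then show ?case using Nil by (simp add: rep_one)
  next
    case (Cons l ls)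
    have "Poly_Mapping.single (Word (l # ls)) 1
        = (free_gen l * Poly_Mapping.single (Word ls) 1 :: 'f free_alg)"
      by (simp add: free_gen_def mult_single)
    then show ?case using Cons gens by (cases l) (auto simp: rep_mult)
  qed
  have monomial: "rep (Poly_Mapping.single u c) w \<in> W" for u c
  proof -
    obtain ls where "u = Word ls" by (cases u)
    moreover have "Poly_Mapping.single u c = free_scalar c * Poly_Mapping.single u 1"
      by (simp add: free_scalar_def mult_single)
    ultimately show ?thesis
      using words[OF w, of ls] W by (simp add: rep_mult rep_scalar subspace_scale)
  qed
  have sum: "rep (\<Sum>u\<in>U. Poly_Mapping.single u (c u)) w \<in> W" if "finite U" for U c
    using that
  proof (induction U rule: finite_induct)
    case empty
    then show ?case using W by (simp add: rep_zero subspace_0)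
  next
    case (insert u U)
    then show ?case using W monomial by (simp add: rep_add subspace_add)
  qed
  have "x = (\<Sum>u\<in>Poly_Mapping.keys x. Poly_Mapping.single u (Poly_Mapping.lookup x u))"
    by (rule poly_mapping_eqI)
       (simp add: lookup_sum lookup_single when_def Poly_Mapping.in_keys_iff)
  then show ?thesis using sum[of "Poly_Mapping.keys x" "Poly_Mapping.lookup x"] by simp
qed

lemma irreducible_invariant:
  assumes "irreducible_module scale (q_Onsager q) (q_Onsager_scalar q) \<rho>"
    and "subspace W" "A ` W \<subseteq> W" "As ` W \<subseteq> W"
  shows "W = {0} \<or> W = UNIV"
proof -
  have "\<rho> X w \<in> W" if X: "X \<in> carrier (q_Onsager q)" and "w \<in> W" for X w
  proof -
    obtain x where "X = q_Onsager_class q x" using X by (rule q_Onsager_carrierE)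
    then show ?thesis using rep_invariant[OF assms(2-4) \<open>w \<in> W\<close>, of x] by (simp add: rep_def)
  qed
  with assms(1,2) show ?thesis unfolding irreducible_module_def by blast
qed

text \<open>
  Each (deformed) commutator with \<open>A\<close> on the left, applied to an eigenvector of \<open>A\<close>, becomes a polynomial
  of degree one in \<open>A\<close> applied to the image of that eigenvector.
\<close>
lemma q_Onsager_relation_eigenvector:
  fixes \<theta> :: 'f
  assumes v: "A v = \<theta> *s v"
  defines "T \<equiv> \<lambda>w. q *s A w - (inverse q * \<theta>) *s w"
    and "S \<equiv> \<lambda>w. inverse q *s A w - (q * \<theta>) *s w"
  shows "A (S (T (As v))) - \<theta> *s S (T (As v)) - ((q\<^sup>2 - (inverse q)\<^sup>2)\<^sup>2) *s (\<theta> *s As v - A (As v)) = 0"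
proof -
  let ?A = "free_gen Letter_A :: 'f free_alg" and ?As = "free_gen Letter_As :: 'f free_alg"
  let ?Y = "qcommutator q ?A ?As"
  let ?Z = "qcommutator (inverse q) ?A ?Y"
  have Y: "rep ?Y v = T (As v)"
    by (simp add: qcommutator_def rep_diff rep_mult rep_scalar T_def v endo_scale[OF endo_rep])
  have Z: "rep ?Z v = S (T (As v))"
    by (simp add: qcommutator_def[of "inverse q"] rep_diff rep_mult rep_scalar Y S_def v
        endo_scale[OF endo_rep])
  have "rep (q_Onsager_relator q ?A ?As) v = 0"
    using rep_zero[of v] by (simp add: rep_def q_Onsager_class_relator)
  then show ?thesis
    unfolding q_Onsager_relator_def commutator_def
    by (simp add: rep_diff rep_mult rep_scalar Z v endo_scale[OF endo_rep])
qed

text \<open>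
  The operator \<open>P\<close> of the q-Onsager relation acts on the eigenspace number \<open>k\<close> of \<open>A\<close> as a scalar \<open>p k\<close>
  and kills \<open>A\<^sup>* v\<close>; hence \<open>A\<^sup>* v\<close> has components only where \<open>p k = 0\<close>.
\<close>
lemma q_Onsager_tridiagonal:
  fixes \<theta> :: "nat \<Rightarrow> 'f"
  assumes dec: "decomposition d (\<lambda>i. eigenspace scale A (\<theta> i))"
    and nonadjacent: "\<And>k. k \<le> d \<Longrightarrow> \<not> (j \<le> k + 1 \<and> k \<le> j + 1) \<Longrightarrow>
      (\<theta> k - \<theta> j) * ((\<theta> k)\<^sup>2 + (\<theta> j)\<^sup>2 - (q\<^sup>2 + (inverse q)\<^sup>2) * \<theta> k * \<theta> j + (q\<^sup>2 - (inverse q)\<^sup>2)\<^sup>2) \<noteq> 0"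
    and q: "q \<noteq> 0" and j: "j \<le> d"
  shows "As ` eigenspace scale A (\<theta> j) \<subseteq>
    subspace_sum scale (\<lambda>i. eigenspace scale A (\<theta> i)) {k. k \<le> d \<and> j \<le> k + 1 \<and> k \<le> j + 1}"
proof clarify
  fix v assume "v \<in> eigenspace scale A (\<theta> j)"
  then have v: "A v = \<theta> j *s v" by (simp add: eigenspace_def)
  let ?V = "\<lambda>i. eigenspace scale A (\<theta> i)" and ?J = "{k. k \<le> d \<and> j \<le> k + 1 \<and> k \<le> j + 1}"
  define T where "T w = q *s A w - (inverse q * \<theta> j) *s w" for w
  define S where "S w = inverse q *s A w - (q * \<theta> j) *s w" for w
  define P where "P w = A (S (T w)) - \<theta> j *s S (T w)
    - ((q\<^sup>2 - (inverse q)\<^sup>2)\<^sup>2) *s (\<theta> j *s w - A w)" for w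
  define p where "p k = (\<theta> k - \<theta> j) * ((\<theta> k)\<^sup>2 + (\<theta> j)\<^sup>2 - (q\<^sup>2 + (inverse q)\<^sup>2) * \<theta> k * \<theta> j
    + (q\<^sup>2 - (inverse q)\<^sup>2)\<^sup>2)" for k
  have A: "endo A" by (rule endo_rep)
  have T: "endo T" and S: "endo S"
    by (simp_all add: T_def S_def endo_iff endo_add[OF A] endo_scale[OF A] algebra_simps)
  have P: "endo P"
    by (simp add: P_def endo_iff endo_add[OF A] endo_scale[OF A] endo_add[OF T] endo_scale[OF T]
        endo_add[OF S] endo_scale[OF S] algebra_simps)
  have "P w = p k *s w" if "w \<in> ?V k" for k w
  proof -
    have w: "A w = \<theta> k *s w" using that by (simp add: eigenspace_def)
    have Tw: "T w = (q * \<theta> k - inverse q * \<theta> j) *s w"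
      by (simp add: T_def w scale_left_diff_distrib)
    have Sw: "S (c *s w) = (c * (inverse q * \<theta> k - q * \<theta> j)) *s w" for c
      by (simp add: S_def w endo_scale[OF A] scale_left_diff_distrib algebra_simps)
    have "P w = ((\<theta> k - \<theta> j) * ((q * \<theta> k - inverse q * \<theta> j) * (inverse q * \<theta> k - q * \<theta> j))
        - (q\<^sup>2 - (inverse q)\<^sup>2)\<^sup>2 * (\<theta> j - \<theta> k)) *s w"
      unfolding P_def Tw Sw endo_scale[OF A] w scale_scale scale_left_diff_distrib[symmetric]
      by (rule arg_cong[where f = "\<lambda>c. c *s w"]) (simp add: algebra_simps)
    also have "(\<theta> k - \<theta> j) * ((q * \<theta> k - inverse q * \<theta> j) * (inverse q * \<theta> k - q * \<theta> j))
        - (q\<^sup>2 - (inverse q)\<^sup>2)\<^sup>2 * (\<theta> j - \<theta> k) = p k"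
      using q by (simp add: p_def field_simps power2_eq_square)
    finally show ?thesis .
  qed
  note P_V = this
  obtain u where u: "\<And>i. i \<in> {..d} \<Longrightarrow> u i \<in> ?V i" "As v = (\<Sum>i\<in>{..d}. u i)"
    using in_subspace_sumE[of "As v" ?V "{..d}"] dec unfolding decomposition_def
    by (metis UNIV_I atMost_iff finite_atMost)
  have "(\<Sum>i\<le>d. p i *s u i) = P (As v)"
    unfolding u(2) endo_sum[OF P] by (rule sum.cong) (simp_all add: P_V[OF u(1)])
  also have "\<dots> = 0"
    using q_Onsager_relation_eigenvector[OF v] by (simp add: P_def S_def T_def)
  finally have "(\<Sum>i\<le>d. p i *s u i) = 0" .
  moreover have "p i *s u i \<in> ?V i" if "i \<le> d" for i
    using u(1) that by (intro subspace_scale subspace_eigenspace A) simp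
  ultimately have pu: "p i *s u i = 0" if "i \<le> d" for i
    using dec that unfolding decomposition_def by (elim conjE allE[of _ "\<lambda>i. p i *s u i"]) blast
  have "As v = (\<Sum>i\<in>?J. u i)"
    unfolding u(2)
  proof (rule sum.mono_neutral_right)
    show "\<forall>i\<in>{..d} - ?J. u i = 0"
      using pu nonadjacent by (auto simp: p_def)
  qed auto
  also have "\<dots> \<in> subspace_sum scale ?V ?J"
    using u(1) by (intro subspace_sum subspace_subspace_sum) (auto intro: subspace_sum_base)
  finally show "As v \<in> subspace_sum scale ?V ?J" .
qed

end

section \<open>The four conjugation formulas\<close>

theorem proposition6p1:
  fixes scale :: "'f::field \<Rightarrow> 'v::ab_group_add \<Rightarrow> 'v"
    and q a :: 'f
    and Basis :: "'v set"
    and \<rho> :: "'f free_alg set \<Rightarrow> 'v \<Rightarrow> 'v"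
    and d :: nat
    and \<theta> :: "nat \<Rightarrow> 'f"
    and Vs :: "nat \<Rightarrow> 'v set"
    and A As H K B Kd Bd :: "'v \<Rightarrow> 'v"
    and V :: "nat \<Rightarrow> 'v set"
    and E :: "nat \<Rightarrow> 'v \<Rightarrow> 'v"
  defines "A \<equiv> \<rho> (q_Onsager_gen q Letter_A)"
    and "As \<equiv> \<rho> (q_Onsager_gen q Letter_As)"
    and "V \<equiv> \<lambda>i. eigenspace scale A (\<theta> i)"
    and "E \<equiv> \<lambda>i. projection_along scale (V i) (subspace_sum scale V ({..d} - {i}))"
    and "H \<equiv> \<lambda>v. \<Sum>i\<le>d. scale (t_coeff q \<theta> i) (E i v)"
    and "K \<equiv> corresponding_map scale q d
           (\<lambda>i. subspace_sum scale Vs {..i} \<inter> subspace_sum scale V {i..d})"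
    and "B \<equiv> corresponding_map scale q d
           (\<lambda>i. subspace_sum scale Vs {..i} \<inter> subspace_sum scale V {..d - i})"
    and "Kd \<equiv> corresponding_map scale q d
           (\<lambda>i. subspace_sum scale Vs {d - i..d} \<inter> subspace_sum scale V {i..d})"
    and "Bd \<equiv> corresponding_map scale q d
           (\<lambda>i. subspace_sum scale Vs {d - i..d} \<inter> subspace_sum scale V {..d - i})"
  assumes q_nonzero: "q \<noteq> 0"
    and q_not_root_of_unity: "\<forall>n::nat. n > 0 \<longrightarrow> q ^ n \<noteq> 1"
    and finite_dim: "finite_dimensional_vector_space scale Basis"
    and dim_ge_2: "vector_space.dim scale (UNIV :: 'v set) \<ge> 2"
    and irreducible: "irreducible_module scale (q_Onsager q) (q_Onsager_scalar q) \<rho>"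
    and diag_A: "diagonalizable scale A"
    and diag_As: "diagonalizable scale As"
    and d_pos: "d \<ge> 1"
    and a_nonzero: "a \<noteq> 0"
    and eigenvalue_ordering: "bij_betw \<theta> {..d} (eigenvalues scale A)"
    and eigenvalue_form: "\<forall>i\<le>d. \<theta> i =
           a * q powi (int d - 2 * int i) + inverse a * q powi (2 * int i - int d)"
    and dual_eigenspace_ordering: "bij_betw Vs {..d} (eigenspaces scale As)"
    and dual_eigenspace_action: "\<forall>i\<le>d. A ` Vs i \<subseteq>
           subspace_sum scale Vs {j. j \<le> d \<and> i \<le> j + 1 \<and> j \<le> i + 1}"
  shows "inv_into UNIV H \<circ> B \<circ> H =
           (\<lambda>v. scale a (A v) - scale (a^2) (inv_into UNIV B v))
       \<and> inv_into UNIV H \<circ> K \<circ> H =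
           (\<lambda>v. scale (inverse a) (A v) - scale (inverse a ^ 2) (inv_into UNIV K v))
       \<and> inv_into UNIV H \<circ> Bd \<circ> H =
           (\<lambda>v. scale a (A v) - scale (a^2) (inv_into UNIV Bd v))
       \<and> inv_into UNIV H \<circ> Kd \<circ> H =
           (\<lambda>v. scale (inverse a) (A v) - scale (inverse a ^ 2) (inv_into UNIV Kd v))"
proof -
  have module: "algebra_module scale (q_Onsager q) (q_Onsager_scalar q) \<rho>"
    using irreducible by (simp add: irreducible_module_def)
  then have vs: "vector_space scale" by (simp add: algebra_module_def)
  interpret M: q_Onsager_module scale q \<rho>
    by (intro q_Onsager_module.intro endomorphisms.intro q_Onsager_module_axioms.intro vs module)
  have A: "M.A = A" and As: "M.As = As"
    by (simp_all add: M.rep_def A_def As_def q_Onsager_gen_def)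
  interpret S: q_Racah_spectrum q a d \<theta>
    using q_nonzero q_not_root_of_unity a_nonzero eigenvalue_ordering eigenvalue_form
    by unfold_locales (auto simp: bij_betw_def)
  have endo_A: "M.endo A" and endo_As: "M.endo As"
    using M.endo_rep A As by metis+
  have theta_range: "\<theta> ` {..d} = eigenvalues scale A"
    using eigenvalue_ordering by (simp add: bij_betw_def)
  have "(\<Union>i\<le>d. V i) = \<Union>(eigenspaces scale A)"
    unfolding eigenspaces_def theta_range[symmetric] by (simp add: V_def)
  then have V_span: "subspace_sum scale V {..d} = UNIV"
    using diag_A by (simp add: subspace_sum_def diagonalizable_def)
  have dec: "M.decomposition d V"
    using V_span unfolding V_def by (intro M.decomposition_eigenspaces endo_A S.theta_inj)
  have "\<exists>c. Vs i = eigenspace scale As c \<and> c \<in> eigenvalues scale As" if "i \<le> d" for i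
    using bij_betwE[OF dual_eigenspace_ordering] that by (auto simp: eigenspaces_def)
  then obtain \<theta>s where Vs: "\<And>i. i \<le> d \<Longrightarrow> Vs i = eigenspace scale As (\<theta>s i)"
    "\<And>i. i \<le> d \<Longrightarrow> \<theta>s i \<in> eigenvalues scale As" by metis
  have nonzero: "eigenspace scale X c \<noteq> {0}" if "c \<in> eigenvalues scale X" for X c
    using that by (auto simp: eigenspace_def eigenvalues_def)
  interpret T: tridiagonal_system scale q a d \<theta> A As \<theta>s V Vs
  proof (intro tridiagonal_system.intro tridiagonal_system_axioms.intro M.endomorphisms_axioms
      S.q_Racah_spectrum_axioms)
    show "As ` V i \<subseteq> subspace_sum scale V {j. j \<le> d \<and> i \<le> j + 1 \<and> j \<le> i + 1}" if "i \<le> d" for i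
      using M.q_Onsager_tridiagonal[of d \<theta> i] dec S.nonadjacent_theta q_nonzero that
      unfolding A As V_def by simp
    show "W = {0} \<or> W = UNIV" if "M.subspace W" "A ` W \<subseteq> W" "As ` W \<subseteq> W" for W
      using M.irreducible_invariant[OF irreducible, of W] that unfolding A As by simp
    show "V i \<noteq> {0}" if "i \<le> d" for i
      unfolding V_def using theta_range that by (intro nonzero) auto
    show "Vs i \<noteq> {0}" if "i \<le> d" for i
      unfolding Vs(1)[OF that] by (intro nonzero Vs(2) that)
    show "A ` Vs i \<subseteq> subspace_sum scale Vs {j. j \<le> d \<and> i \<le> j + 1 \<and> j \<le> i + 1}" if "i \<le> d" for i
      using dual_eigenspace_action that by simp
  qed (rule endo_A endo_As V_span | (rule Vs(1), assumption) | simp add: V_def)+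
  note E = M.projection_along_spec[OF dec]
  have endo_H: "M.endo H"
    unfolding H_def E_def
    by (simp add: M.endo_iff M.endo_add[OF E(1)] M.endo_scale[OF E(1)] M.scale_right_distrib
        sum.distrib M.scale_sum_right mult.commute)
  have H_V: "H v = scale (t_coeff q \<theta> i) v" if "i \<le> d" "v \<in> V i" for i v
  proof -
    have "H v = (\<Sum>j\<le>d. if j = i then scale (t_coeff q \<theta> i) v else 0)"
      unfolding H_def E_def using E(2)[OF _ that] by (intro sum.cong) auto
    then show ?thesis using that by simp
  qed
  have H_V_reverse: "H v = scale (t_coeff q \<theta> (d - i)) v" if "i \<le> d" "v \<in> V (d - i)" for i v
    using that by (intro H_V) simp_all
  \<comment> \<open>The four maps are the map \<open>K\<close> of the four choices of orderings.\<close>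
  interpret TVs: tridiagonal_system scale q a d \<theta> A As "\<lambda>i. \<theta>s (d - i)" V "\<lambda>i. Vs (d - i)"
    by (rule T.reverse_Vs)
  interpret TV: tridiagonal_system scale q "inverse a" d "\<lambda>i. \<theta> (d - i)" A As \<theta>s "\<lambda>i. V (d - i)" Vs
    by (rule T.reverse_V)
  interpret TVVs: tridiagonal_system scale q "inverse a" d "\<lambda>i. \<theta> (d - i)" A As
    "\<lambda>i. \<theta>s (d - i)" "\<lambda>i. V (d - i)" "\<lambda>i. Vs (d - i)"
    by (rule TVs.reverse_V)
  have sums: "subspace_sum scale (\<lambda>i. Vs (d - i)) {..i} = subspace_sum scale Vs {d - i..d}"
    "subspace_sum scale (\<lambda>i. V (d - i)) {i..d} = subspace_sum scale V {..d - i}" if "i \<le> d" for i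
    using that by (simp_all add: M.subspace_sum_reverse image_diff_atMost_le image_diff_atLeastAtMost)
  have K: "K = corresponding_map scale q d
      (\<lambda>i. subspace_sum scale Vs {..i} \<inter> subspace_sum scale V {i..d})"
    by (rule K_def[THEN meta_eq_to_obj_eq])
  have B: "B = corresponding_map scale q d
      (\<lambda>i. subspace_sum scale Vs {..i} \<inter> subspace_sum scale (\<lambda>i. V (d - i)) {i..d})"
    unfolding B_def by (rule M.corresponding_map_cong) (simp add: sums)
  have Kd: "Kd = corresponding_map scale q d
      (\<lambda>i. subspace_sum scale (\<lambda>i. Vs (d - i)) {..i} \<inter> subspace_sum scale V {i..d})"
    unfolding Kd_def by (rule M.corresponding_map_cong) (simp add: sums)
  have Bd: "Bd = corresponding_map scale q d
      (\<lambda>i. subspace_sum scale (\<lambda>i. Vs (d - i)) {..i} \<inter> subspace_sum scale (\<lambda>i. V (d - i)) {i..d})"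
    unfolding Bd_def by (rule M.corresponding_map_cong) (simp add: sums)
  have t_reverse_nonzero: "t_coeff q \<theta> (d - i) \<noteq> 0" for i
    by (rule S.t_coeff_nonzero) simp
  note t_reverse = T.t_reverse[of "t_coeff q \<theta>", OF S.t_coeff_Suc]
  show ?thesis
    using T.K_conjugate[OF endo_H H_V S.t_coeff_Suc S.t_coeff_nonzero, folded K]
      TVs.K_conjugate[OF endo_H H_V S.t_coeff_Suc S.t_coeff_nonzero, folded Kd]
      TV.K_conjugate[OF endo_H H_V_reverse t_reverse t_reverse_nonzero, folded B]
      TVVs.K_conjugate[OF endo_H H_V_reverse t_reverse t_reverse_nonzero, folded Bd]
    by simp
qed

end
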